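(* Every reflection tree is a Sidorenko graph. That is, if $H$ is a reflection tree with $e$ edges, then for every graphon $W$ we have $t(H,W)\geq t(P_2,W)^{e}$, where $t(P_2,W)=\int_{[0,1]^2}W(x,y)\,dx\,dy$.
   Context: A graphon is a symmetric measurable function $W:[0,1]^2\to[0,1]$. For a finite graph $H$ with vertices $x_1,\dots,x_m$, the homomorphism density is $t(H,W)=\int_{[0,1]^m}\prod_{(x_i,x_j)\in E(H)}W(x_i,x_j)\,dx_1\cdots dx_m$; $P_2$ denotes the graph consisting of a single edge. A bipartite graph $H$ with $e$ edges is a Sidorenko graph if $t(H,W)\geq t(P_2,W)^e$ for every graphon $W$. Reflection: let $T$ be a tree, let $T'$ be a subtree of $T$ with vertex set $K$, and let $S\subseteq K$ be an independent set. Reflecting $T'$ along $S$ means adding a new vertex-disjoint copy of $T'$ to the graph and identifying the copy of each vertex of $S$ with the original vertex of $S$ (the resulting multiple edges, if any, are reduced to single edges). A reflection tree is a graph obtained from a tree $T$ by applying this reflection operation to a collection of subtrees of $T$ (each along an independent set of its vertices), each new copy being glued to $T$. For example, even cycles (reflect a path along its two endpoints) and bipartite graphs in which one vertex is adjacent to every vertex of the other side are reflection trees. *)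

theory Defs
  imports "HOL-Analysis.Analysis"
begin

datatype 'a ugraph = Graph (verts: "'a set") (edges: "'a set set")

definition simple_graph :: "'a ugraph \<Rightarrow> bool" where
  "simple_graph G \<longleftrightarrow> finite (verts G) \<and>
     (\<forall>e\<in>edges G. \<exists>u\<in>verts G. \<exists>v\<in>verts G. u \<noteq> v \<and> e = {u, v})"

definition subgraph :: "'a ugraph \<Rightarrow> 'a ugraph \<Rightarrow> bool" where
  "subgraph G' G \<longleftrightarrow> verts G' \<subseteq> verts G \<and> edges G' \<subseteq> edges G"

definition graph_connected :: "'a ugraph \<Rightarrow> bool" where
  "graph_connected G \<longleftrightarrow> verts G \<noteq> {} \<and>
     (\<forall>u\<in>verts G. \<forall>v\<in>verts G. (u, v) \<in> {(a, b). {a, b} \<in> edges G}\<^sup>*)"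

definition is_cycle :: "'a ugraph \<Rightarrow> 'a list \<Rightarrow> bool" where
  "is_cycle G vs \<longleftrightarrow> 3 \<le> length vs \<and> distinct vs \<and>
     (\<forall>i<length vs. {vs ! i, vs ! (Suc i mod length vs)} \<in> edges G)"

definition tree :: "'a ugraph \<Rightarrow> bool" where
  "tree G \<longleftrightarrow> simple_graph G \<and> graph_connected G \<and> (\<nexists>vs. is_cycle G vs)"

definition independent_set :: "'a ugraph \<Rightarrow> 'a set \<Rightarrow> bool" where
  "independent_set G S \<longleftrightarrow> S \<subseteq> verts G \<and> (\<forall>u\<in>S. \<forall>v\<in>S. {u, v} \<notin> edges G)"

definition bipartite :: "'a ugraph \<Rightarrow> bool" where
  "bipartite G \<longleftrightarrow> (\<exists>A B. A \<union> B = verts G \<and> A \<inter> B = {} \<and>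
     (\<forall>e\<in>edges G. \<exists>a\<in>A. \<exists>b\<in>B. e = {a, b}))"

text \<open>
  \<open>is_reflection G T' S G'\<close>: the graph \<open>G'\<close> arises from \<open>G\<close> by reflecting \<open>T'\<close> along \<open>S\<close>.
  The map \<open>\<phi>\<close> sends each vertex of \<open>T'\<close> to its copy: vertices of \<open>S\<close> are identified with
  their copies, all other copies are new. Edges form a set, so multiple edges are merged.
\<close>

definition is_reflection ::
  "'a ugraph \<Rightarrow> 'a ugraph \<Rightarrow> 'a set \<Rightarrow> 'a ugraph \<Rightarrow> bool" where
  "is_reflection G T' S G' \<longleftrightarrow>
     (\<exists>\<phi>. inj_on \<phi> (verts T') \<and> (\<forall>v\<in>S. \<phi> v = v) \<and>
          \<phi> ` (verts T' - S) \<inter> verts G = {} \<and>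
          G' = Graph (verts G \<union> \<phi> ` verts T') (edges G \<union> (\<lambda>e. \<phi> ` e) ` edges T'))"

text \<open>
  Every reflected subtree is a subtree of the initial tree \<open>T\<close>, not of an intermediate graph.
  The same subtree may be reflected repeatedly, along the same or different independent sets.
\<close>

inductive reflections :: "'a ugraph \<Rightarrow> 'a ugraph \<Rightarrow> bool" for T :: "'a ugraph" where
  base: "reflections T T"
| reflect: "\<lbrakk>reflections T G; tree T'; subgraph T' T;
             S \<subseteq> verts T'; independent_set T S; is_reflection G T' S G'\<rbrakk>
            \<Longrightarrow> reflections T G'"

definition reflection_tree :: "'a ugraph \<Rightarrow> bool" where
  "reflection_tree H \<longleftrightarrow> (\<exists>T. tree T \<and> reflections T H)"

definition graphon :: "(real \<Rightarrow> real \<Rightarrow> real) \<Rightarrow> bool" where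
  "graphon W \<longleftrightarrow>
     (\<lambda>(x, y). W x y) \<in> borel_measurable (lebesgue_on ({0..1} \<times> {0..1})) \<and>
     (\<forall>x\<in>{0..1}. \<forall>y\<in>{0..1}. W x y \<in> {0..1} \<and> W x y = W y x)"

text \<open>
  Edges are unordered, so the factor of an edge is the value \<open>W (x u) (x v)\<close> common to both
  orderings of its endpoints; it is unique because \<open>W\<close> is symmetric on the unit square.
\<close>

definition edge_weight :: "(real \<Rightarrow> real \<Rightarrow> real) \<Rightarrow> ('a \<Rightarrow> real) \<Rightarrow> 'a set \<Rightarrow> real" where
  "edge_weight W x e = (THE r. \<exists>u v. e = {u, v} \<and> r = W (x u) (x v))"

lemma edge_weight_eq:
  assumes "graphon W" "x u \<in> {0..1}" "x v \<in> {0..1}"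
  shows "edge_weight W x {u, v} = W (x u) (x v)"
proof -
  have "W (x u) (x v) = W (x v) (x u)"
    using assms unfolding graphon_def by blast
  then show ?thesis
    unfolding edge_weight_def by (intro the_equality) (auto simp: doubleton_eq_iff)
qed

text \<open>
  The product measure is completed, i.e. it is Lebesgue measure on the cube, because \<open>W\<close> is
  only assumed to be Lebesgue measurable.
\<close>

definition hom_density :: "'a ugraph \<Rightarrow> (real \<Rightarrow> real \<Rightarrow> real) \<Rightarrow> real" where
  "hom_density H W =
     (\<integral>x. (\<Prod>e\<in>edges H. edge_weight W x e)
        \<partial>(completion (Pi\<^sub>M (verts H) (\<lambda>_. restrict_space lborel {0..1}))))"

definition P2 :: "nat ugraph" where
  "P2 = Graph {0, 1} {{0, 1}}"

definition sidorenko_graph :: "'a ugraph \<Rightarrow> bool" where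
  "sidorenko_graph H \<longleftrightarrow> simple_graph H \<and> bipartite H \<and>
     (\<forall>W. graphon W \<longrightarrow> hom_density H W \<ge> hom_density P2 W ^ card (edges H))"

end

theory Submission
  imports Defs "HOL-Probability.Infinite_Product_Measure"
begin

text \<open>
  Let \<open>W\<close> be a graphon bounded away from zero, with edge density \<open>p\<close>. The stationary random walk
  with kernel \<open>W\<close>, run along a tree \<open>T\<close>, has a joint density \<open>f\<^sub>T\<close> on the positions of the vertices,
  and the marginal of \<open>f\<^sub>T\<close> on a subtree \<open>T'\<close> is \<open>f\<^sub>T\<^sub>'\<close>, because leaves can be integrated out one at a
  time.
  Writing \<open>w\<^sub>T\<close> for the product of the edge weights of \<open>T\<close>, a direct computation and convexity of
  \<open>x ln x\<close> give \<open>\<integral> f\<^sub>T ln (w\<^sub>T / f\<^sub>T) \<ge> e(T) ln p\<close>. By Gibbs' inequality, \<open>\<integral> f\<^sub>T ln c \<ge> e(T) ln p\<close>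
  whenever \<open>\<integral> w\<^sub>T / c \<le> 1\<close>.

  For a graph \<open>G\<close> obtained from \<open>T\<close> by reflections this is strengthened to
  \<open>ln \<integral> w\<^sub>G exp h \<ge> e(G) ln p + \<integral> f\<^sub>T h\<close> for every bounded function \<open>h\<close> of the positions of the
  vertices of \<open>T\<close>. Reflecting \<open>T'\<close> along \<open>S\<close> multiplies the integrand by \<open>g\<close>, the integral of \<open>w\<^sub>T\<^sub>'\<close> over the
  vertices outside \<open>S\<close>, so one passes from \<open>h\<close> to \<open>h + ln g\<close> and uses
  \<open>\<integral> f\<^sub>T ln g = \<integral> f\<^sub>T\<^sub>' ln g \<ge> e(T') ln p\<close>, which is the previous inequality with \<open>c = g\<close>. The case
  \<open>h = 0\<close> is the claim; a general graphon is a limit of graphons bounded away from zero.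
\<close>

section \<open>Trees grow from subtrees by adding leaves\<close>

text \<open>The starting graph is a parameter and not just a single vertex: started at a subtree
  \<open>T'\<close> of \<open>T\<close>, induction on \<open>grows\<close> deals with the vertices
  of \<open>T\<close> outside \<open>T'\<close> one at a time.\<close>

inductive grows :: "'a ugraph \<Rightarrow> 'a ugraph \<Rightarrow> bool" for T' :: "'a ugraph" where
  grow_refl: "grows T' T'"
| grow_leaf: "\<lbrakk>grows T' T; u \<in> verts T; v \<notin> verts T\<rbrakk>
    \<Longrightarrow> grows T' (Graph (insert v (verts T)) (insert {u, v} (edges T)))"

text \<open>A walk is made simple as it is built: if the next vertex already lies on the path, the
  path is cut back to it, otherwise it is appended. Distinctness is what \<open>is_cycle\<close>
  asks for.\<close>

lemma rtrancl_simple_path: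
  assumes "(u, v) \<in> R\<^sup>*"
  shows "\<exists>xs. xs \<noteq> [] \<and> hd xs = u \<and> last xs = v \<and> distinct xs \<and>
    (\<forall>i. Suc i < length xs \<longrightarrow> (xs ! i, xs ! Suc i) \<in> R)"
  using assms
proof (induction rule: rtrancl_induct)
  case base
  show ?case by (intro exI[of _ "[u]"]) auto
next
  case (step y z)
  then obtain xs where xs: "xs \<noteq> []" "hd xs = u" "last xs = y" "distinct xs"
    "\<And>i. Suc i < length xs \<Longrightarrow> (xs ! i, xs ! Suc i) \<in> R" by blast
  show ?case
  proof (cases "z \<in> set xs")
    case True
    then obtain k where k: "k < length xs" "xs ! k = z" by (auto simp: in_set_conv_nth)
    then show ?thesis
      using xs by (intro exI[of _ "take (Suc k) xs"])
        (auto simp: take_Suc_conv_app_nth[of k, symmetric] last_conv_nth min_def le_Suc_eq not_le)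
  next
    case False
    have "(if i < length xs then xs ! i else z, if Suc i < length xs then xs ! Suc i else z) \<in> R"
      if "i < length xs" for i
    proof (cases "Suc i < length xs")
      case True then show ?thesis using xs(5) by auto
    next
      case False
      then have "i = length xs - 1" using that by auto
      then have "xs ! i = y" using xs by (simp add: last_conv_nth)
      then show ?thesis using step False that by auto
    qed
    then have "((xs @ [z]) ! i, (xs @ [z]) ! Suc i) \<in> R" if "Suc i < length (xs @ [z])" for i
      using that by (force simp: nth_append)
    then show ?thesis
      using xs False by (intro exI[of _ "xs @ [z]"]) auto
  qed
qed

lemma simple_graph_edgeE:
  assumes "simple_graph G" "e \<in> edges G"
  obtains u v where "u \<in> verts G" "v \<in> verts G" "u \<noteq> v" "e = {u, v}"
  using assms unfolding simple_graph_def by blast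

lemma finite_edges: "simple_graph G \<Longrightarrow> finite (edges G)"
  unfolding simple_graph_def by (rule finite_subset[of _ "Pow (verts G)"]) auto

lemma simple_graph_leaf:
  assumes "simple_graph G" "u \<in> verts G" "v \<notin> verts G"
  shows "simple_graph (Graph (insert v (verts G)) (insert {u, v} (edges G)))"
  unfolding simple_graph_def
proof (intro conjI ballI)
  show "finite (verts (Graph (insert v (verts G)) (insert {u, v} (edges G))))"
    using assms by (simp add: simple_graph_def)
next
  fix e assume "e \<in> edges (Graph (insert v (verts G)) (insert {u, v} (edges G)))"
  then consider "e = {u, v}" | "e \<in> edges G" by auto
  then show "\<exists>a\<in>verts (Graph (insert v (verts G)) (insert {u, v} (edges G))).
    \<exists>b\<in>verts (Graph (insert v (verts G)) (insert {u, v} (edges G))). a \<noteq> b \<and> e = {a, b}"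
  proof cases
    case 1
    then show ?thesis using assms by auto
  next
    case 2
    then obtain a b where "a \<in> verts G" "b \<in> verts G" "a \<noteq> b" "e = {a, b}"
      using assms(1) by (auto simp: simple_graph_def)
    then show ?thesis by auto
  qed
qed

lemma edges_subset_verts: "simple_graph G \<Longrightarrow> e \<in> edges G \<Longrightarrow> e \<subseteq> verts G"
  by (elim simple_graph_edgeE) auto

lemma is_cycle_mono: "subgraph G' G \<Longrightarrow> is_cycle G' vs \<Longrightarrow> is_cycle G vs"
  unfolding subgraph_def is_cycle_def by blast

text \<open>An edge of \<open>T\<close> missing from \<open>T'\<close> would close the simple path
  in \<open>T'\<close> between its ends to a cycle of \<open>T\<close>.\<close>

lemma spanning_subtree_eq:
  assumes T': "tree T'" and T: "tree T" and sub: "subgraph T' T" and V: "verts T' = verts T"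
  shows "T' = T"
proof (rule ccontr)
  assume "T' \<noteq> T"
  then have "edges T' \<noteq> edges T" using V by (metis ugraph.exhaust_sel)
  then obtain e where e: "e \<in> edges T" "e \<notin> edges T'" using sub unfolding subgraph_def by auto
  then obtain u v where uv: "u \<in> verts T" "v \<in> verts T" "u \<noteq> v" "e = {u, v}"
    using T simple_graph_edgeE unfolding tree_def by blast
  then have "(u, v) \<in> {(a, b). {a, b} \<in> edges T'}\<^sup>*"
    using T' V unfolding tree_def graph_connected_def by auto
  from rtrancl_simple_path[OF this] obtain xs
    where xs: "xs \<noteq> []" "hd xs = u" "last xs = v" "distinct xs"
    "\<And>i. Suc i < length xs \<Longrightarrow> {xs ! i, xs ! Suc i} \<in> edges T'" by auto
  \<comment> \<open>One vertex would force \<open>u = v\<close>, and two would put the missing edge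
    itself into \<open>T'\<close>; so the closed path has the three vertices that a cycle
    needs.\<close>
  have "length xs \<noteq> 1" using xs uv by (cases xs) auto
  moreover have "length xs \<noteq> 2"
  proof
    assume *: "length xs = 2"
    then have "xs ! 0 = u" "xs ! 1 = v" using xs by (auto simp: hd_conv_nth last_conv_nth)
    then show False using xs(5)[of 0] * e uv by auto
  qed
  moreover have "length xs \<noteq> 0" using xs by simp
  ultimately have len: "3 \<le> length xs" by linarith
  have "{xs ! i, xs ! (Suc i mod length xs)} \<in> edges T" if i: "i < length xs" for i
  proof (cases "Suc i < length xs")
    case True
    then show ?thesis using xs(5) sub unfolding subgraph_def by auto
  next
    case False
    then have [simp]: "Suc i = length xs" using i by simp
    have "xs ! i = v" using xs \<open>Suc i = length xs\<close> by (metis diff_Suc_1 last_conv_nth)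
    then show ?thesis using xs e uv by (simp add: hd_conv_nth insert_commute)
  qed
  then have "is_cycle T xs" using len xs unfolding is_cycle_def by auto
  then show False using T unfolding tree_def by blast
qed

lemma rtrancl_leaves_set:
  assumes "(a, b) \<in> R\<^sup>*" "a \<in> A" "b \<notin> A"
  shows "\<exists>u v. (u, v) \<in> R \<and> u \<in> A \<and> v \<notin> A"
  using assms by (induction rule: rtrancl_induct) auto

text \<open>A path in \<open>T\<close> from \<open>T'\<close> to a missing vertex has an edge that
  leaves \<open>T'\<close>. Adding it keeps the graph connected, and acyclic as a subgraph of
  \<open>T\<close>. Once no vertex is missing, \<open>spanning_subtree_eq\<close> applies. The start
  \<open>T\<^sub>0\<close> stays fixed while \<open>T'\<close> moves towards
  \<open>T\<close>.\<close>

lemma subtree_grows_from: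
  assumes "grows T\<^sub>0 T'" "tree T'" "tree T" "subgraph T' T"
  shows "grows T\<^sub>0 T"
  using assms
proof (induction "card (verts T - verts T')" arbitrary: T' rule: less_induct)
  case less
  have fin: "finite (verts T)" using less.prems unfolding tree_def simple_graph_def by blast
  show ?case
  proof (cases "verts T' = verts T")
    case True
    then show ?thesis using spanning_subtree_eq less.prems by blast
  next
    case False
    then obtain b where b: "b \<in> verts T" "b \<notin> verts T'"
      using less.prems unfolding subgraph_def by auto
    obtain a where a: "a \<in> verts T'"
      using less.prems unfolding tree_def graph_connected_def by auto
    have "(a, b) \<in> {(a, b). {a, b} \<in> edges T}\<^sup>*"
      using a b less.prems unfolding tree_def graph_connected_def subgraph_def by blast
    from rtrancl_leaves_set[OF this a b(2)] obtain u v
      where uv: "{u, v} \<in> edges T" "u \<in> verts T'" "v \<notin> verts T'" by auto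
    then have v: "v \<in> verts T"
      using less.prems(3) edges_subset_verts[of T] unfolding tree_def by blast
    define T'' where "T'' = Graph (insert v (verts T')) (insert {u, v} (edges T'))"
    have sub: "subgraph T'' T"
      using less.prems uv v unfolding T''_def subgraph_def by auto
    have "graph_connected T''"
    proof -
      let ?R = "{(a, b). {a, b} \<in> edges T''}\<^sup>*"
      have "{(a, b). {a, b} \<in> edges T'} \<subseteq> {(a, b). {a, b} \<in> edges T''}"
        unfolding T''_def by auto
      then have old: "(x, y) \<in> ?R" if "x \<in> verts T'" "y \<in> verts T'" for x y
        using that less.prems(2) unfolding tree_def graph_connected_def
        using rtrancl_mono[of "{(a, b). {a, b} \<in> edges T'}"] by blast
      have new: "(u, v) \<in> ?R" "(v, u) \<in> ?R"
        unfolding T''_def by (auto intro!: r_into_rtrancl simp: insert_commute)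
      have "(x, y) \<in> ?R" if "x \<in> insert v (verts T')" "y \<in> insert v (verts T')" for x y
        using that old[of x y] old[OF _ uv(2), of x] old[OF uv(2), of y] new
        by (elim insertE) (auto intro: rtrancl_trans[of x u] rtrancl_trans[of v u])
      then show ?thesis unfolding graph_connected_def by (simp add: T''_def)
    qed
    moreover have "simple_graph T''"
      using simple_graph_leaf less.prems(2) uv unfolding T''_def tree_def by auto
    ultimately have "tree T''"
      using is_cycle_mono[OF sub] less.prems(3) unfolding tree_def by blast
    moreover have "card (verts T - verts T'') < card (verts T - verts T')"
      using fin v uv by (intro psubset_card_mono) (auto simp: T''_def)
    moreover have "grows T\<^sub>0 T''"
      unfolding T''_def using less.prems(1) uv by (intro grow_leaf) auto
    ultimately show ?thesis using less.hyps[of T''] less.prems(3) sub by blast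
  qed
qed

lemma subtree_grows: "\<lbrakk>tree T'; tree T; subgraph T' T\<rbrakk> \<Longrightarrow> grows T' T"
  by (rule subtree_grows_from[OF grow_refl])

lemma tree_singleton: "tree (Graph {r} {})"
  unfolding tree_def simple_graph_def graph_connected_def is_cycle_def
  by (auto intro: exI[of _ 0])

lemma vertex_grows: "tree T \<Longrightarrow> r \<in> verts T \<Longrightarrow> grows (Graph {r} {}) T"
  by (rule subtree_grows) (auto simp: tree_singleton subgraph_def)

lemma grows_simple: "grows T' T \<Longrightarrow> simple_graph T' \<Longrightarrow> simple_graph T"
  by (induction rule: grows.induct) (auto intro: simple_graph_leaf)

lemma grows_subgraph: "grows T' T \<Longrightarrow> subgraph T' T"
  by (induction rule: grows.induct) (auto simp: subgraph_def)

lemma leaf_edge_fresh: "simple_graph T \<Longrightarrow> v \<notin> verts T \<Longrightarrow> {u, v} \<notin> edges T"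
  using edges_subset_verts by blast

text \<open>Growing from one vertex, each leaf brings one new vertex and one edge, which is new
  because it contains that vertex.\<close>

lemma card_verts_tree:
  assumes "tree T"
  shows "card (verts T) = card (edges T) + 1"
proof -
  obtain r where r: "r \<in> verts T" using assms unfolding tree_def graph_connected_def by auto
  have s: "simple_graph (Graph {r} {})" using tree_singleton[of r] unfolding tree_def by blast
  show ?thesis using vertex_grows[OF assms r]
  proof (induction rule: grows.induct)
    case (grow_leaf T u v)
    have T: "simple_graph T" using grows_simple grow_leaf s by blast
    have "finite (verts T)" using T by (simp add: simple_graph_def)
    then show ?case using grow_leaf leaf_edge_fresh[OF T] finite_edges[OF T] by simp
  qed simp
qed

section \<open>Proper two-colourings of trees\<close>

definition colours :: "('a \<Rightarrow> bool) \<Rightarrow> 'a ugraph \<Rightarrow> bool" where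
  "colours c G \<longleftrightarrow> (\<forall>u v. {u, v} \<in> edges G \<longrightarrow> c u \<noteq> c v)"

lemma bipartite_if_colours:
  assumes "colours c G" "simple_graph G"
  shows "bipartite G"
  unfolding bipartite_def
proof (rule exI[of _ "{v \<in> verts G. c v}"], rule exI[of _ "{v \<in> verts G. \<not> c v}"], intro conjI ballI)
  fix e assume e: "e \<in> edges G"
  then obtain u v where uv: "u \<in> verts G" "v \<in> verts G" "e = {u, v}"
    using assms simple_graph_edgeE by blast
  then have "c u \<noteq> c v" using assms e unfolding colours_def by blast
  then show "\<exists>a\<in>{v \<in> verts G. c v}. \<exists>b\<in>{v \<in> verts G. \<not> c v}. e = {a, b}"
    using uv by (cases "c u") (auto simp: insert_commute)
qed auto

lemma tree_colours:
  assumes "tree T"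
  shows "\<exists>c. colours c T"
proof -
  obtain r where r: "r \<in> verts T" using assms unfolding tree_def graph_connected_def by auto
  have s: "simple_graph (Graph {r} {})" using tree_singleton[of r] unfolding tree_def by blast
  show ?thesis using vertex_grows[OF assms r]
  proof (induction rule: grows.induct)
    case (grow_leaf T u v)
    have T: "simple_graph T" using grows_simple grow_leaf s by blast
    obtain c where c: "colours c T" using grow_leaf by blast
    have "a \<noteq> v \<and> b \<noteq> v" if "{a, b} \<in> edges T" for a b
      using leaf_edge_fresh[OF T grow_leaf(3)] that by (metis insert_commute)
    then have "colours (c(v := \<not> c u)) (Graph (insert v (verts T)) (insert {u, v} (edges T)))"
      using c grow_leaf(2,3) unfolding colours_def by (auto simp: doubleton_eq_iff)
    then show ?case by blast
  qed (auto simp: colours_def)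
qed

section \<open>Reflections\<close>

text \<open>One reflection with its copy map \<phi> fixed, detached from the initial tree:
  \<open>G\<close> may be any intermediate graph, and independence of \<open>S\<close> is stated
  through the edges of \<open>T'\<close>.\<close>

locale reflection_step =
  fixes G T' :: "'a ugraph" and S :: "'a set" and \<phi> :: "'a \<Rightarrow> 'a"
  assumes G: "simple_graph G" and T': "simple_graph T'"
    and S: "S \<subseteq> verts T'" "S \<subseteq> verts G" "\<And>u v. {u, v} \<in> edges T' \<Longrightarrow> u \<in> S \<Longrightarrow> v \<notin> S"
    and inj: "inj_on \<phi> (verts T')" and fix_S: "\<And>v. v \<in> S \<Longrightarrow> \<phi> v = v"
    and fresh: "\<phi> ` (verts T' - S) \<inter> verts G = {}"
begin

definition "reflected = Graph (verts G \<union> \<phi> ` verts T') (edges G \<union> (\<lambda>e. \<phi> ` e) ` edges T')"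

lemma fresh_iff: "v \<in> verts T' \<Longrightarrow> \<phi> v \<in> verts G \<longleftrightarrow> v \<in> S"
  using fresh fix_S S by auto

lemma simple_reflected: "simple_graph reflected"
  unfolding simple_graph_def
proof (intro conjI ballI)
  show "finite (verts reflected)"
    using G T' unfolding reflected_def simple_graph_def by simp
next
  fix e assume "e \<in> edges reflected"
  then consider "e \<in> edges G" | e' where "e' \<in> edges T'" "e = \<phi> ` e'"
    unfolding reflected_def by auto
  then show "\<exists>u\<in>verts reflected. \<exists>v\<in>verts reflected. u \<noteq> v \<and> e = {u, v}"
  proof cases
    case 1
    then obtain u v where "u \<in> verts G" "v \<in> verts G" "u \<noteq> v" "e = {u, v}"
      using G simple_graph_edgeE by blast
    then show ?thesis unfolding reflected_def by auto
  next
    case 2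
    obtain u v where "u \<in> verts T'" "v \<in> verts T'" "u \<noteq> v" "e' = {u, v}"
      using simple_graph_edgeE[OF T' 2(1)] by blast
    then have "\<phi> u \<in> verts reflected" "\<phi> v \<in> verts reflected" "\<phi> u \<noteq> \<phi> v" "e = {\<phi> u, \<phi> v}"
      using 2 inj by (auto simp: reflected_def inj_on_eq_iff)
    then show ?thesis by blast
  qed
qed

text \<open>This is where independence of \<open>S\<close> enters: an edge of \<open>T'\<close>
  whose copy has both ends in \<open>G\<close> would join two vertices of \<open>S\<close>. Hence no
  edges are merged, edge numbers add up exactly and edge weights multiply.\<close>

lemma new_edges_disjoint: "edges G \<inter> (\<lambda>e. \<phi> ` e) ` edges T' = {}"
proof -
  have "\<phi> ` e \<notin> edges G" if e: "e \<in> edges T'" for e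
  proof
    assume *: "\<phi> ` e \<in> edges G"
    obtain u v where uv: "u \<in> verts T'" "v \<in> verts T'" "e = {u, v}"
      using T' simple_graph_edgeE e by blast
    have "\<phi> u \<in> verts G" "\<phi> v \<in> verts G" using edges_subset_verts[OF G *] uv by auto
    then show False using fresh_iff uv S(3) e by blast
  qed
  then show ?thesis by auto
qed

lemma inj_on_new_edges: "inj_on (\<lambda>e. \<phi> ` e) (edges T')"
  by (rule inj_on_subset[OF inj_on_image_Pow[OF inj]]) (use edges_subset_verts[OF T'] in auto)

lemma card_edges_reflected: "card (edges reflected) = card (edges G) + card (edges T')"
  unfolding reflected_def using new_edges_disjoint inj_on_new_edges finite_edges[OF G] finite_edges[OF T']
  by (simp add: card_Un_disjoint card_image)

text \<open>Each copy inherits the colour of its original. This is consistent on the glued vertices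
  because \<phi> fixes \<open>S\<close>.\<close>

lemma colours_reflected:
  assumes c: "colours c G" and c': "colours c T'"
  shows "\<exists>c'. colours c' reflected \<and> (\<forall>v\<in>verts G. c' v = c v)"
proof -
  define c2 where "c2 v = (if v \<in> verts G then c v else c (the_inv_into (verts T') \<phi> v))" for v
  have old: "c2 v = c v" if "v \<in> verts G" for v using that by (simp add: c2_def)
  have new: "c2 (\<phi> v) = c v" if "v \<in> verts T'" for v
    using fresh_iff[OF that] fix_S[of v] the_inv_into_f_f[OF inj that] by (auto simp: c2_def)
  have "c2 u \<noteq> c2 v" if "{u, v} \<in> edges reflected" for u v
  proof -
    have "{u, v} \<in> edges G \<or> {u, v} \<in> (\<lambda>e. \<phi> ` e) ` edges T'"
      using that unfolding reflected_def by simp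
    then consider "{u, v} \<in> edges G" | e' where "e' \<in> edges T'" "{u, v} = \<phi> ` e'"
      by (elim disjE imageE)
    then show ?thesis
    proof cases
      case 1
      then have "c2 u = c u" "c2 v = c v" using edges_subset_verts[OF G 1] old by simp_all
      then show ?thesis using c 1 unfolding colours_def by simp
    next
      case 2
      obtain a b where ab: "a \<in> verts T'" "b \<in> verts T'" "e' = {a, b}"
        using simple_graph_edgeE[OF T' 2(1)] by blast
      have "c a \<noteq> c b" using 2(1) c' ab(3) unfolding colours_def by blast
      then have "c2 (\<phi> a) \<noteq> c2 (\<phi> b)" using new[OF ab(1)] new[OF ab(2)] by simp
      moreover have "{u, v} = {\<phi> a, \<phi> b}" using 2(2) ab(3) by simp
      ultimately show ?thesis unfolding doubleton_eq_iff by metis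
    qed
  qed
  then show ?thesis using old unfolding colours_def by (intro exI[of _ c2]) simp
qed

end

lemma is_reflectionE:
  assumes "is_reflection G T' S G'" "simple_graph G" "verts T \<subseteq> verts G"
    and "tree T'" "subgraph T' T" "S \<subseteq> verts T'" "independent_set T S"
  obtains \<phi> where "reflection_step G T' S \<phi>" "G' = reflection_step.reflected G T' \<phi>"
proof -
  from assms(1) obtain \<phi> where \<phi>: "inj_on \<phi> (verts T')" "\<forall>v\<in>S. \<phi> v = v"
    "\<phi> ` (verts T' - S) \<inter> verts G = {}"
    "G' = Graph (verts G \<union> \<phi> ` verts T') (edges G \<union> (\<lambda>e. \<phi> ` e) ` edges T')"
    unfolding is_reflection_def by blast
  interpret reflection_step G T' S \<phi>
  proof
    show "simple_graph G" "S \<subseteq> verts T'" "inj_on \<phi> (verts T')"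
      "\<phi> ` (verts T' - S) \<inter> verts G = {}" by fact+
    show "simple_graph T'" using assms(4) by (simp add: tree_def)
    show "S \<subseteq> verts G" using assms(3,7) by (auto simp: independent_set_def)
    show "v \<notin> S" if "{u, v} \<in> edges T'" "u \<in> S" for u v
      using that assms(5,7) unfolding independent_set_def subgraph_def by blast
    show "\<phi> v = v" if "v \<in> S" for v using that \<phi>(2) by simp
  qed
  show ?thesis using that reflection_step_axioms \<phi>(4) reflected_def by simp
qed

lemma reflections_invariant:
  assumes "reflections T G" "tree T"
  shows "simple_graph G \<and> verts T \<subseteq> verts G"
  using assms
proof (induction rule: reflections.induct)
  case base
  then show ?case unfolding tree_def by simp
next
  case (reflect G T' S G')
  then obtain \<phi> where \<phi>: "reflection_step G T' S \<phi>" "G' = reflection_step.reflected G T' \<phi>"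
    using is_reflectionE by metis
  interpret reflection_step G T' S \<phi> by fact
  show ?case using simple_reflected reflect \<phi>(2) by (auto simp: reflected_def)
qed

lemma reflections_edgeless:
  assumes "reflections T G" "edges T = {}"
  shows "edges G = {}"
  using assms by (induction rule: reflections.induct) (auto simp: is_reflection_def subgraph_def)

lemma colours_subgraph: "colours c T \<Longrightarrow> subgraph T' T \<Longrightarrow> colours c T'"
  unfolding colours_def subgraph_def by blast

lemma colours_cong:
  "colours c T \<Longrightarrow> simple_graph T \<Longrightarrow> (\<And>v. v \<in> verts T \<Longrightarrow> c' v = c v) \<Longrightarrow> colours c' T"
  unfolding colours_def using edges_subset_verts[of T] by (metis insert_subset)

text \<open>The conjunct for \<open>T\<close> is carried through the induction because the next
  subtree lies in \<open>T\<close>, so the same colouring is proper on it and can be transferred to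
  its copy.\<close>

lemma reflections_colours:
  assumes "reflections T G" "tree T"
  shows "\<exists>c. colours c G \<and> colours c T"
  using assms
proof (induction rule: reflections.induct)
  case base
  then show ?case using tree_colours by blast
next
  case (reflect G T' S G')
  have SG: "simple_graph G" and VG: "verts T \<subseteq> verts G"
    using reflections_invariant reflect by blast+
  then obtain \<phi> where \<phi>: "reflection_step G T' S \<phi>" "G' = reflection_step.reflected G T' \<phi>"
    using is_reflectionE reflect by metis
  interpret reflection_step G T' S \<phi> by fact
  obtain c where c: "colours c G" "colours c T" using reflect by blast
  obtain c' where c': "colours c' reflected" "\<forall>v\<in>verts G. c' v = c v"
    using colours_reflected[OF c(1) colours_subgraph[OF c(2)]] reflect by blast
  have "colours c' T"
    by (rule colours_cong[OF c(2)]) (use c'(2) VG reflect.prems in \<open>auto simp: tree_def\<close>)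
  then show ?case using c' \<phi> by blast
qed

lemma reflections_bipartite:
  "reflections T G \<Longrightarrow> tree T \<Longrightarrow> simple_graph G \<and> bipartite G"
  using reflections_colours reflections_invariant bipartite_if_colours by blast

section \<open>Bounded measurable functions\<close>

definition bounded_meas :: "'b measure \<Rightarrow> ('b \<Rightarrow> real) \<Rightarrow> bool" where
  "bounded_meas N f \<longleftrightarrow> f \<in> borel_measurable N \<and> (\<exists>B. \<forall>x\<in>space N. \<bar>f x\<bar> \<le> B)"

text \<open>The lower bound is a positive constant and both bounds hold at every point. The class is
  therefore closed under products, quotients and partial integrals, and its logarithms are bounded,
  so all integrability obligations below reduce to \<open>bounded_meas\<close>.\<close>

definition positive_meas :: "'b measure \<Rightarrow> ('b \<Rightarrow> real) \<Rightarrow> bool" where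
  "positive_meas N f \<longleftrightarrow> f \<in> borel_measurable N \<and> (\<exists>a>0. \<exists>B. \<forall>x\<in>space N. a \<le> f x \<and> f x \<le> B)"

lemma bounded_measI: "f \<in> borel_measurable N \<Longrightarrow> (\<And>x. x \<in> space N \<Longrightarrow> \<bar>f x\<bar> \<le> B) \<Longrightarrow> bounded_meas N f"
  unfolding bounded_meas_def by blast

lemma positive_measI:
  "f \<in> borel_measurable N \<Longrightarrow> 0 < a \<Longrightarrow> (\<And>x. x \<in> space N \<Longrightarrow> a \<le> f x) \<Longrightarrow>
    (\<And>x. x \<in> space N \<Longrightarrow> f x \<le> B) \<Longrightarrow> positive_meas N f"
  unfolding positive_meas_def by blast

lemma bounded_measE:
  assumes "bounded_meas N f"
  obtains B where "f \<in> borel_measurable N" "\<And>x. x \<in> space N \<Longrightarrow> \<bar>f x\<bar> \<le> B" "0 \<le> B"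
proof -
  from assms obtain B where "f \<in> borel_measurable N" "\<And>x. x \<in> space N \<Longrightarrow> \<bar>f x\<bar> \<le> B"
    unfolding bounded_meas_def by blast
  then show ?thesis by (intro that[of "\<bar>B\<bar>"]) (auto intro: order_trans[OF _ abs_ge_self])
qed

lemma positive_measE:
  assumes "positive_meas N f"
  obtains a B where "f \<in> borel_measurable N" "0 < a" "0 < B"
    "\<And>x. x \<in> space N \<Longrightarrow> a \<le> f x" "\<And>x. x \<in> space N \<Longrightarrow> f x \<le> B"
proof -
  from assms obtain a B where *: "f \<in> borel_measurable N" "0 < a"
    "\<And>x. x \<in> space N \<Longrightarrow> a \<le> f x \<and> f x \<le> B"
    unfolding positive_meas_def by blast
  \<comment> \<open>On an empty space \<open>B\<close> is arbitrary; the maximum makes the upper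
    bound positive in any case.\<close>
  have "f x \<le> max B 1" if "x \<in> space N" for x using *(3)[OF that] by linarith
  then show ?thesis using * by (intro that[of a "max B 1"]) auto
qed

lemma positive_meas_pos: "positive_meas N f \<Longrightarrow> x \<in> space N \<Longrightarrow> 0 < f x"
  unfolding positive_meas_def by force

lemma positive_meas_measurable: "positive_meas N f \<Longrightarrow> f \<in> borel_measurable N"
  unfolding positive_meas_def by blast

lemma bounded_meas_measurable: "bounded_meas N f \<Longrightarrow> f \<in> borel_measurable N"
  unfolding bounded_meas_def by blast

lemma positive_meas_bounded: "positive_meas N f \<Longrightarrow> bounded_meas N f"
  unfolding positive_meas_def by (force intro!: bounded_measI)

lemma bounded_meas_const: "bounded_meas N (\<lambda>_. c)"
  by (rule bounded_measI[of _ _ "\<bar>c\<bar>"]) auto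

lemma bounded_meas_add:
  assumes "bounded_meas N f" "bounded_meas N g"
  shows "bounded_meas N (\<lambda>x. f x + g x)"
proof -
  obtain B where B: "f \<in> borel_measurable N" "\<And>x. x \<in> space N \<Longrightarrow> \<bar>f x\<bar> \<le> B"
    using assms(1) by (elim bounded_measE) blast
  obtain C where C: "g \<in> borel_measurable N" "\<And>x. x \<in> space N \<Longrightarrow> \<bar>g x\<bar> \<le> C"
    using assms(2) by (elim bounded_measE) blast
  show ?thesis
  proof (rule bounded_measI)
    show "(\<lambda>x. f x + g x) \<in> borel_measurable N" using B(1) C(1) by measurable
    show "\<bar>f x + g x\<bar> \<le> B + C" if "x \<in> space N" for x using B(2)[OF that] C(2)[OF that] by linarith
  qed
qed

lemma bounded_meas_mult:
  assumes "bounded_meas N f" "bounded_meas N g"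
  shows "bounded_meas N (\<lambda>x. f x * g x)"
proof -
  obtain B where B: "f \<in> borel_measurable N" "\<And>x. x \<in> space N \<Longrightarrow> \<bar>f x\<bar> \<le> B" "0 \<le> B"
    using assms(1) by (elim bounded_measE) blast
  obtain C where C: "g \<in> borel_measurable N" "\<And>x. x \<in> space N \<Longrightarrow> \<bar>g x\<bar> \<le> C" "0 \<le> C"
    using assms(2) by (elim bounded_measE) blast
  show ?thesis
  proof (rule bounded_measI)
    show "(\<lambda>x. f x * g x) \<in> borel_measurable N" using B(1) C(1) by measurable
    show "\<bar>f x * g x\<bar> \<le> B * C" if "x \<in> space N" for x
      unfolding abs_mult using B(2)[OF that] C(2)[OF that] B(3) by (intro mult_mono) auto
  qed
qed

lemma bounded_meas_diff:
  "bounded_meas N f \<Longrightarrow> bounded_meas N g \<Longrightarrow> bounded_meas N (\<lambda>x. f x - g x)"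
  using bounded_meas_add[of N f "\<lambda>x. -1 * g x"] bounded_meas_mult[OF bounded_meas_const[of N "-1"], of g]
  by simp

lemma positive_meas_const: "0 < c \<Longrightarrow> positive_meas N (\<lambda>_. c)"
  by (rule positive_measI[of _ _ c c]) auto

lemma positive_meas_mult:
  assumes "positive_meas N f" "positive_meas N g"
  shows "positive_meas N (\<lambda>x. f x * g x)"
proof -
  obtain a B where B: "f \<in> borel_measurable N" "0 < a"
    "\<And>x. x \<in> space N \<Longrightarrow> a \<le> f x" "\<And>x. x \<in> space N \<Longrightarrow> f x \<le> B" "0 < B"
    using assms(1) by (elim positive_measE) blast
  obtain b C where C: "g \<in> borel_measurable N" "0 < b"
    "\<And>x. x \<in> space N \<Longrightarrow> b \<le> g x" "\<And>x. x \<in> space N \<Longrightarrow> g x \<le> C" "0 < C"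
    using assms(2) by (elim positive_measE) blast
  show ?thesis
  proof (rule positive_measI)
    show "(\<lambda>x. f x * g x) \<in> borel_measurable N" using B(1) C(1) by measurable
    show "0 < a * b" using B C by simp
    show "a * b \<le> f x * g x" "f x * g x \<le> B * C" if "x \<in> space N" for x
      using B(2,3,4,5) C(2,3,4,5) that positive_meas_pos[OF assms(1) that] positive_meas_pos[OF assms(2) that]
      by (auto intro!: mult_mono)
  qed
qed

lemma positive_meas_inverse:
  assumes "positive_meas N f"
  shows "positive_meas N (\<lambda>x. inverse (f x))"
proof -
  obtain a B where B: "f \<in> borel_measurable N" "0 < a" "0 < B"
    "\<And>x. x \<in> space N \<Longrightarrow> a \<le> f x" "\<And>x. x \<in> space N \<Longrightarrow> f x \<le> B"
    using assms(1) by (elim positive_measE) blast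
  show ?thesis
  proof (rule positive_measI)
    show "(\<lambda>x. inverse (f x)) \<in> borel_measurable N" using B(1) by measurable
    show "0 < inverse B" using B by simp
    show "inverse B \<le> inverse (f x)" "inverse (f x) \<le> inverse a" if "x \<in> space N" for x
      using B(2,3) B(4,5)[OF that] by (auto intro!: le_imp_inverse_le)
  qed
qed

lemma positive_meas_divide:
  "positive_meas N f \<Longrightarrow> positive_meas N g \<Longrightarrow> positive_meas N (\<lambda>x. f x / g x)"
  unfolding divide_inverse by (intro positive_meas_mult positive_meas_inverse)

lemma positive_meas_prod:
  "(\<And>i. i \<in> I \<Longrightarrow> positive_meas N (f i)) \<Longrightarrow> positive_meas N (\<lambda>x. \<Prod>i\<in>I. f i x)"
  by (induction I rule: infinite_finite_induct) (auto intro: positive_meas_const positive_meas_mult)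

lemma positive_meas_exp:
  assumes "bounded_meas N f"
  shows "positive_meas N (\<lambda>x. exp (f x))"
proof -
  obtain B where B: "f \<in> borel_measurable N" "\<And>x. x \<in> space N \<Longrightarrow> \<bar>f x\<bar> \<le> B"
    using assms(1) by (elim bounded_measE) blast
  show ?thesis
  proof (rule positive_measI)
    show "(\<lambda>x. exp (f x)) \<in> borel_measurable N" using B(1) by measurable
    show "exp (-B) \<le> exp (f x)" "exp (f x) \<le> exp B" if "x \<in> space N" for x
      using B(2)[OF that] by auto
  qed simp
qed

lemma bounded_meas_ln:
  assumes "positive_meas N f"
  shows "bounded_meas N (\<lambda>x. ln (f x))"
proof -
  obtain a B where B: "f \<in> borel_measurable N" "0 < a" "0 < B"
    "\<And>x. x \<in> space N \<Longrightarrow> a \<le> f x" "\<And>x. x \<in> space N \<Longrightarrow> f x \<le> B"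
    using assms(1) by (elim positive_measE) blast
  show ?thesis
  proof (rule bounded_measI)
    show "(\<lambda>x. ln (f x)) \<in> borel_measurable N" using B(1) by measurable
    show "\<bar>ln (f x)\<bar> \<le> \<bar>ln a\<bar> + \<bar>ln B\<bar>" if "x \<in> space N" for x
    proof -
      have "ln a \<le> ln (f x)" "ln (f x) \<le> ln B"
        using B(2,3) B(4,5)[OF that] by (auto intro!: ln_mono)
      then show ?thesis by linarith
    qed
  qed
qed

lemma positive_meas_compose:
  assumes "positive_meas N f" "g \<in> measurable N' N"
  shows "positive_meas N' (\<lambda>x. f (g x))"
proof -
  obtain a B where B: "f \<in> borel_measurable N" "0 < a" "0 < B"
    "\<And>x. x \<in> space N \<Longrightarrow> a \<le> f x" "\<And>x. x \<in> space N \<Longrightarrow> f x \<le> B"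
    using assms(1) by (elim positive_measE) blast
  show ?thesis
    using B measurable_space[OF assms(2)] measurable_compose[OF assms(2) B(1)]
    by (intro positive_measI[of _ _ a B]) auto
qed

lemma bounded_meas_compose:
  assumes "bounded_meas N f" "g \<in> measurable N' N"
  shows "bounded_meas N' (\<lambda>x. f (g x))"
proof -
  obtain B where B: "f \<in> borel_measurable N" "\<And>x. x \<in> space N \<Longrightarrow> \<bar>f x\<bar> \<le> B"
    using assms(1) by (elim bounded_measE) blast
  show ?thesis
    using B measurable_space[OF assms(2)] measurable_compose[OF assms(2) B(1)]
    by (intro bounded_measI[of _ _ B]) auto
qed

lemma (in finite_measure) bounded_meas_integrable:
  assumes "bounded_meas M f"
  shows "integrable M f"
proof -
  obtain B where "f \<in> borel_measurable M" "\<And>x. x \<in> space M \<Longrightarrow> \<bar>f x\<bar> \<le> B"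
    using assms by (elim bounded_measE) blast
  then show ?thesis by (intro integrable_const_bound[of _ B]) auto
qed

text \<open>Averaging over a probability space preserves the constant bounds.\<close>

lemma (in prob_space) positive_meas_integral:
  assumes "positive_meas (N \<Otimes>\<^sub>M M) (\<lambda>(x, y). f x y)"
  shows "positive_meas N (\<lambda>x. \<integral>y. f x y \<partial>M)"
proof -
  obtain a B where B: "(\<lambda>(x, y). f x y) \<in> borel_measurable (N \<Otimes>\<^sub>M M)" "0 < a" "0 < B"
    "\<And>z. z \<in> space (N \<Otimes>\<^sub>M M) \<Longrightarrow> a \<le> (case z of (x, y) \<Rightarrow> f x y)"
    "\<And>z. z \<in> space (N \<Otimes>\<^sub>M M) \<Longrightarrow> (case z of (x, y) \<Rightarrow> f x y) \<le> B"
    using assms(1) by (elim positive_measE) blast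
  have b: "a \<le> f x y" "f x y \<le> B" if "x \<in> space N" "y \<in> space M" for x y
    using B(4,5)[of "(x, y)"] that by (auto simp: space_pair_measure)
  show ?thesis
  proof (rule positive_measI)
    show "(\<lambda>x. \<integral>y. f x y \<partial>M) \<in> borel_measurable N" using B(1) by measurable
    fix x assume x: "x \<in> space N"
    have "(\<lambda>y. f x y) \<in> borel_measurable M" using B(1) x by measurable
    then have int: "integrable M (f x)"
      using b[OF x] B(2)
      by (intro bounded_meas_integrable positive_meas_bounded positive_measI[of _ _ a B]) auto
    show "a \<le> (\<integral>y. f x y \<partial>M)"
      using b[OF x] int by (intro integral_ge_const) auto
    show "(\<integral>y. f x y \<partial>M) \<le> B"
      using b[OF x] int by (intro integral_le_const) auto
  qed fact
qed

lemma (in prob_space) positive_meas_integral_pos: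
  assumes "positive_meas M f"
  shows "0 < (\<integral>x. f x \<partial>M)"
proof -
  obtain a B where B: "0 < a" "\<And>x. x \<in> space M \<Longrightarrow> a \<le> f x"
    using assms(1) by (elim positive_measE) blast
  have "a \<le> (\<integral>x. f x \<partial>M)"
    using B bounded_meas_integrable[OF positive_meas_bounded[OF assms]]
    by (intro integral_ge_const) auto
  then show ?thesis using B by simp
qed

lemmas meas_intros = bounded_meas_const bounded_meas_add bounded_meas_diff bounded_meas_mult
  bounded_meas_ln positive_meas_const positive_meas_mult positive_meas_divide
  positive_meas_prod positive_meas_exp

section \<open>Infinite powers of a probability space\<close>

text \<open>Every element of the type gets a coordinate, whether or not it is a vertex. Functions
  attached to different graphs then live on one space, and adding vertices does not change the
  measure.\<close>

abbreviation power_measure :: "'b measure \<Rightarrow> ('a \<Rightarrow> 'b) measure" where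
  "power_measure M \<equiv> Pi\<^sub>M UNIV (\<lambda>_. M)"

text \<open>Replaces the statement that \<open>h\<close> is a function on the product over
  \<open>V\<close> alone.\<close>

definition depends_on :: "'a set \<Rightarrow> (('a \<Rightarrow> 'b) \<Rightarrow> 'c) \<Rightarrow> bool" where
  "depends_on V h \<longleftrightarrow> (\<forall>x y. (\<forall>v\<in>V. x v = y v) \<longrightarrow> h x = h y)"

lemma depends_onD: "depends_on V h \<Longrightarrow> (\<And>v. v \<in> V \<Longrightarrow> x v = y v) \<Longrightarrow> h x = h y"
  unfolding depends_on_def by blast

lemma depends_on_mono: "depends_on V h \<Longrightarrow> V \<subseteq> V' \<Longrightarrow> depends_on V' h"
  unfolding depends_on_def by blast

text \<open>The coordinates in \<open>A\<close> are drawn afresh from a second sample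
  \<open>y\<close>. The relabelling \<psi> lets the copy of a vertex read \<open>y\<close> at the
  original vertex.\<close>

definition resample :: "'a set \<Rightarrow> ('a \<Rightarrow> 'a) \<Rightarrow> ('a \<Rightarrow> 'b) \<Rightarrow> ('a \<Rightarrow> 'b) \<Rightarrow> 'a \<Rightarrow> 'b" where
  "resample A \<psi> x y = (\<lambda>v. if v \<in> A then y (\<psi> v) else x v)"

lemma measurable_resample:
  "(\<lambda>(x, y). resample A \<psi> x y) \<in> measurable (power_measure M \<Otimes>\<^sub>M power_measure M) (power_measure M)"
  unfolding resample_def split_beta'
proof (rule measurable_PiM_single')
  fix v
  show "(\<lambda>z. if v \<in> A then snd z (\<psi> v) else fst z v) \<in> power_measure M \<Otimes>\<^sub>M power_measure M \<rightarrow>\<^sub>M M"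
    by (cases "v \<in> A") simp_all
qed (auto simp: space_pair_measure space_PiM PiE_iff)

text \<open>It suffices to compare cylinders. The preimage of a cylinder is a rectangle: each
  constraint falls either on \<open>x\<close> or on \<open>y\<close>, and injectivity of \<psi>
  sends different constraints to different coordinates of \<open>y\<close>, so the product of the
  factors is unchanged.\<close>

lemma distr_resample:
  fixes M :: "'b measure" and A :: "'a set"
  assumes "prob_space M" and \<psi>: "inj_on \<psi> A"
  shows "distr (power_measure M \<Otimes>\<^sub>M power_measure M) (power_measure M) (\<lambda>(x, y). resample A \<psi> x y)
    = power_measure M"
proof -
  interpret prob_space M by fact
  interpret P: product_prob_space "\<lambda>_::'a. M" UNIV by unfold_locales
  interpret PP: pair_prob_space "power_measure M :: ('a \<Rightarrow> 'b) measure"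
    "power_measure M :: ('a \<Rightarrow> 'b) measure" ..
  let ?O = "power_measure M :: ('a \<Rightarrow> 'b) measure"
  show ?thesis
  proof (rule P.PiM_eq)
    fix J :: "'a set" and F
    assume J: "finite J" "\<And>j. j \<in> J \<Longrightarrow> F j \<in> sets M"
    let ?X = "prod_emb UNIV (\<lambda>_. M) J (Pi\<^sub>E J F)"
    \<comment> \<open>Finds, for a coordinate of \<open>y\<close>, the coordinate in
      \<open>A\<close> whose constraint it inherits.\<close>
    define k where "k = the_inv_into A \<psi>"
    have k: "k (\<psi> v) = v" if "v \<in> A" for v using that \<psi> by (simp add: k_def the_inv_into_f_f)
    let ?E = "{x \<in> space ?O. \<forall>i\<in>J - A. x i \<in> F i}"
    let ?F = "{x \<in> space ?O. \<forall>i\<in>\<psi> ` (J \<inter> A). x i \<in> F (k i)}"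
    have "(\<lambda>(x, y). resample A \<psi> x y) -` ?X \<inter> space (?O \<Otimes>\<^sub>M ?O) = ?E \<times> ?F"
      using k
      by (auto simp: space_pair_measure space_PiM prod_emb_def PiE_iff resample_def split: if_splits)
    moreover have "?X \<in> sets ?O" using J by (intro sets_PiM_I) auto
    ultimately have "emeasure (distr (?O \<Otimes>\<^sub>M ?O) ?O (\<lambda>(x, y). resample A \<psi> x y)) ?X
        = emeasure (?O \<Otimes>\<^sub>M ?O) (?E \<times> ?F)"
      using measurable_resample by (subst emeasure_distr) auto
    also have "\<dots> = emeasure ?O ?E * emeasure ?O ?F"
    proof (rule sigma_finite_measure.emeasure_pair_measure_Times)
      show "sigma_finite_measure ?O" by unfold_locales
      have *: "{x \<in> space ?O. x i \<in> B} \<in> sets ?O" if "B \<in> sets M" for i B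
        using that by (intro sets_Collect_single) auto
      show "?E \<in> sets ?O" using J by (intro sets.sets_Collect_finite_All * ) auto
      show "?F \<in> sets ?O" using J k by (intro sets.sets_Collect_finite_All * ) auto
    qed
    also have "emeasure ?O ?E = (\<Prod>i\<in>J - A. emeasure M (F i))"
      using J by (intro P.emeasure_PiM_Collect) auto
    also have "emeasure ?O ?F = (\<Prod>i\<in>\<psi> ` (J \<inter> A). emeasure M (F (k i)))"
      using J k by (intro P.emeasure_PiM_Collect) auto
    also have "\<dots> = (\<Prod>i\<in>J \<inter> A. emeasure M (F i))"
      using \<psi> k by (subst prod.reindex) (auto intro: inj_on_subset)
    also have "(\<Prod>i\<in>J - A. emeasure M (F i)) * \<dots> = (\<Prod>i\<in>J. emeasure M (F i))"
      using J prod.Int_Diff[of J "\<lambda>i. emeasure M (F i)" A] by (simp add: mult.commute)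
    finally show "emeasure (distr (?O \<Otimes>\<^sub>M ?O) ?O (\<lambda>(x, y). resample A \<psi> x y)) ?X
      = (\<Prod>i\<in>J. emeasure M (F i))" .
  qed simp
qed

text \<open>Fubini in the form used throughout: the coordinates in \<open>A\<close> are integrated
  first, with the others held fixed in \<open>x\<close>.\<close>

lemma integral_resample:
  fixes M :: "'b measure" and A :: "'a set"
  assumes "prob_space M" and \<psi>: "inj_on \<psi> A" and h: "bounded_meas (power_measure M) h"
  shows "(\<integral>x. h x \<partial>power_measure M)
    = (\<integral>x. (\<integral>y. h (resample A \<psi> x y) \<partial>power_measure M) \<partial>power_measure M)"
proof -
  interpret prob_space M by fact
  interpret P: product_prob_space "\<lambda>_::'a. M" UNIV by unfold_locales
  interpret PP: pair_prob_space "power_measure M :: ('a \<Rightarrow> 'b) measure"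
    "power_measure M :: ('a \<Rightarrow> 'b) measure" ..
  let ?O = "power_measure M :: ('a \<Rightarrow> 'b) measure"
  let ?r = "\<lambda>(x, y). resample A \<psi> x y"
  have "(\<integral>x. h x \<partial>?O) = (\<integral>z. h (?r z) \<partial>(?O \<Otimes>\<^sub>M ?O))"
    by (subst distr_resample[OF assms(1,2), symmetric], rule integral_distr)
      (use measurable_resample bounded_meas_measurable[OF h] in auto)
  also have "\<dots> = (\<integral>x. (\<integral>y. h (?r (x, y)) \<partial>?O) \<partial>?O)"
    by (rule PP.integral_fst'[symmetric], rule PP.bounded_meas_integrable)
      (rule bounded_meas_compose[OF h measurable_resample])
  finally show ?thesis by simp
qed

lemma integral_component:
  fixes M :: "'b measure" and v :: 'a
  assumes "prob_space M" and f: "f \<in> borel_measurable M"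
  shows "(\<integral>y. f (y v) \<partial>power_measure M) = (\<integral>t. (f t :: real) \<partial>M)"
proof -
  interpret prob_space M by fact
  interpret P: product_prob_space "\<lambda>_::'a. M" UNIV by unfold_locales
  show ?thesis
    using integral_distr[OF _ f, of "\<lambda>y. y v" "power_measure M"] P.PiM_component[of v] by simp
qed

section \<open>Weights of graphs\<close>

definition graph_weight :: "(real \<Rightarrow> real \<Rightarrow> real) \<Rightarrow> 'a ugraph \<Rightarrow> ('a \<Rightarrow> real) \<Rightarrow> real" where
  "graph_weight U G x = (\<Prod>e\<in>edges G. edge_weight U x e)"

text \<open>Companion of \<open>edge_weight_eq\<close> for kernels that are symmetric on the whole
  plane, so positions are not restricted to the unit interval.\<close>

lemma edge_weight_sym:
  assumes "\<And>s t. U s t = U t s"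
  shows "edge_weight U x {u, v} = U (x u) (x v)"
  unfolding edge_weight_def using assms
  by (intro the_equality) (auto simp: doubleton_eq_iff)

lemma edge_weight_cong:
  assumes "\<And>v. v \<in> e \<Longrightarrow> x v = y v"
  shows "edge_weight U x e = edge_weight U y e"
proof -
  have "(\<exists>u v. e = {u, v} \<and> r = U (x u) (x v)) \<longleftrightarrow> (\<exists>u v. e = {u, v} \<and> r = U (y u) (y v))" for r
    using assms by (metis insertCI)
  then show ?thesis unfolding edge_weight_def by simp
qed

lemma graph_weight_depends_on:
  assumes "simple_graph G"
  shows "depends_on (verts G) (graph_weight U G)"
  unfolding depends_on_def graph_weight_def
proof (intro allI impI prod.cong refl)
  fix x y :: "'a \<Rightarrow> real" and e
  assume *: "\<forall>v\<in>verts G. x v = y v" "e \<in> edges G"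
  show "edge_weight U x e = edge_weight U y e"
    by (rule edge_weight_cong) (use * edges_subset_verts[OF assms *(2)] in auto)
qed

context reflection_step
begin

text \<open>Old and new edges are disjoint and the edges of \<open>T'\<close> are copied
  injectively, so the product splits; the copy of \<open>T'\<close> at \<open>x\<close> has the
  weight of \<open>T'\<close> at positions pulled back along \<phi>.\<close>

lemma graph_weight_reflected:
  assumes "\<And>s t. U s t = U t s"
  shows "graph_weight U reflected x = graph_weight U G x * graph_weight U T' (x \<circ> \<phi>)"
proof -
  have "(\<Prod>e\<in>(\<lambda>e. \<phi> ` e) ` edges T'. edge_weight U x e) = (\<Prod>e\<in>edges T'. edge_weight U (x \<circ> \<phi>) e)"
  proof (subst prod.reindex[OF inj_on_new_edges], rule prod.cong[OF refl])
    fix e assume "e \<in> edges T'"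
    then obtain u v where "e = {u, v}" using simple_graph_edgeE[OF T'] by metis
    then show "(edge_weight U x \<circ> (`) \<phi>) e = edge_weight U (x \<circ> \<phi>) e"
      by (simp add: edge_weight_sym[of U, OF assms])
  qed
  then show ?thesis
    unfolding graph_weight_def reflected_def
    using new_edges_disjoint finite_edges[OF G] finite_edges[OF T']
    by (simp add: prod.union_disjoint)
qed

text \<open>Redrawing exactly the new vertices leaves \<open>G\<close> at \<open>x\<close>, while
  the copy of \<open>T'\<close> sees \<open>x\<close> on \<open>S\<close> and the fresh sample
  elsewhere. Integrating over \<open>y\<close> thus gives the weight of \<open>G\<close> times a
  function of the positions of \<open>S\<close>.\<close>

lemma graph_weight_resample:
  assumes sym: "\<And>s t. U s t = U t s" and N: "N = \<phi> ` (verts T' - S)"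
    and \<psi>: "\<psi> = the_inv_into (verts T') \<phi>"
  shows "graph_weight U reflected (resample N \<psi> x y)
    = graph_weight U G x * graph_weight U T' (resample (- S) id x y)"
proof -
  let ?z = "resample N \<psi> x y"
  have "graph_weight U G ?z = graph_weight U G x"
    by (rule depends_onD[OF graph_weight_depends_on[OF G]])
      (use fresh N in \<open>auto simp: resample_def\<close>)
  moreover have "graph_weight U T' (?z \<circ> \<phi>) = graph_weight U T' (resample (- S) id x y)"
  proof (rule depends_onD[OF graph_weight_depends_on[OF T']])
    fix v assume v: "v \<in> verts T'"
    have "\<phi> v \<in> N \<longleftrightarrow> v \<notin> S"
    proof
      assume "\<phi> v \<in> N"
      then show "v \<notin> S" using fresh_iff[OF v] fresh N by auto
    next
      assume "v \<notin> S"
      then show "\<phi> v \<in> N" using v N by auto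
    qed
    then show "(?z \<circ> \<phi>) v = resample (- S) id x y v"
      using v fix_S the_inv_into_f_f[OF inj v] by (auto simp: resample_def \<psi>)
  qed
  ultimately show ?thesis using graph_weight_reflected[OF sym] by simp
qed

end

section \<open>The Markov density on a tree\<close>

text \<open>\<open>M\<close> will be Lebesgue measure on the unit interval. The kernel is bounded
  away from zero so that all quotients and logarithms stay bounded.\<close>

locale positive_graphon = prob_space M for M :: "real measure" +
  fixes W :: "real \<Rightarrow> real \<Rightarrow> real"
  assumes W_pos: "positive_meas (M \<Otimes>\<^sub>M M) (\<lambda>(s, t). W s t)"
    and W_sym: "W s t = W t s"
begin

definition deg :: "real \<Rightarrow> real" where "deg s = (\<integral>t. W s t \<partial>M)"
definition p :: real where "p = (\<integral>s. deg s \<partial>M)"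
definition q :: "real \<Rightarrow> real" where "q s = deg s / p"
definition K :: "real \<Rightarrow> real \<Rightarrow> real" where "K s t = W s t / (p * (q s * q t))"

text \<open>The joint density of the stationary random walk with kernel \<open>W\<close> indexed by the tree \<open>T\<close>:
  \<open>q\<close> is the stationary density and \<open>K\<close> the transition kernel relative to it.\<close>

definition tree_density :: "'a ugraph \<Rightarrow> ('a \<Rightarrow> real) \<Rightarrow> real" where
  "tree_density T x = (\<Prod>v\<in>verts T. q (x v)) * graph_weight K T x"

abbreviation \<Omega> :: "('a \<Rightarrow> real) measure" where "\<Omega> \<equiv> power_measure M"

lemma \<Omega>_prob: "prob_space (\<Omega> :: ('a \<Rightarrow> real) measure)"
  by (rule prob_space_PiM) unfold_locales

lemma integrable_\<Omega>: "bounded_meas \<Omega> f \<Longrightarrow> integrable \<Omega> f"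
  by (rule finite_measure.bounded_meas_integrable[OF prob_space.finite_measure[OF \<Omega>_prob]])

lemma component_space: "x \<in> space \<Omega> \<Longrightarrow> x v \<in> space M"
  by (auto simp: space_PiM PiE_iff)

lemma deg_pos: "positive_meas M deg"
  unfolding deg_def[abs_def] using positive_meas_integral[OF W_pos] .

lemma p_pos: "0 < p"
  unfolding p_def using positive_meas_integral_pos[OF deg_pos] .

lemma q_pos: "positive_meas M q"
  unfolding q_def[abs_def] using deg_pos p_pos by (intro meas_intros)

lemma K_pos: "positive_meas (M \<Otimes>\<^sub>M M) (\<lambda>(s, t). K s t)"
proof -
  have "positive_meas (M \<Otimes>\<^sub>M M) (\<lambda>z. (case z of (s, t) \<Rightarrow> W s t) / (p * (q (fst z) * q (snd z))))"
    by (intro meas_intros W_pos p_pos positive_meas_compose[OF q_pos]) auto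
  then show ?thesis unfolding K_def by (simp add: split_beta')
qed

lemma K_sym: "K s t = K t s"
  unfolding K_def using W_sym[of s t] by (simp add: mult.commute)

lemma edge_weight_W: "edge_weight W x {u, v} = W (x u) (x v)"
  using W_sym by (rule edge_weight_sym)

lemma edge_weight_K: "edge_weight K x {u, v} = K (x u) (x v)"
  using K_sym by (rule edge_weight_sym)

lemma q_integral: "(\<integral>s. q s \<partial>M) = 1"
  using p_pos unfolding q_def by (simp flip: p_def)

text \<open>As \<open>p * q s = deg s\<close>, the integrand is \<open>W s t / deg s\<close>, the
  transition density of the walk from \<open>s\<close>.\<close>

lemma K_integral:
  assumes "s \<in> space M"
  shows "(\<integral>t. q t * K s t \<partial>M) = 1"
proof -
  have *: "0 < q s" "0 < deg s" using positive_meas_pos[OF q_pos assms] positive_meas_pos[OF deg_pos assms] .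
  have "(\<integral>t. q t * K s t \<partial>M) = (\<integral>t. W s t / (p * q s) \<partial>M)"
  proof (rule Bochner_Integration.integral_cong[OF refl])
    fix t assume "t \<in> space M"
    then have "0 < q t" using positive_meas_pos[OF q_pos] by blast
    then show "q t * K s t = W s t / (p * q s)" unfolding K_def using * p_pos
      by (simp add: field_simps)
  qed
  also have "\<dots> = deg s / (p * q s)" by (simp add: deg_def)
  also have "\<dots> = 1" unfolding q_def using * p_pos by simp
  finally show ?thesis .
qed

lemma pair_pos:
  assumes "positive_meas (M \<Otimes>\<^sub>M M) (\<lambda>(s, t). U s t)"
  shows "positive_meas \<Omega> (\<lambda>x. U (x u) (x v))"
  using positive_meas_compose[OF assms, of "\<lambda>x. (x u, x v)" \<Omega>] by simp

lemma graph_weight_pos: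
  assumes "positive_meas (M \<Otimes>\<^sub>M M) (\<lambda>(s, t). U s t)" "\<And>s t. U s t = U t s" "simple_graph G"
  shows "positive_meas \<Omega> (graph_weight U G)"
  unfolding graph_weight_def[abs_def]
proof (rule positive_meas_prod)
  fix e assume "e \<in> edges G"
  then obtain u v where "e = {u, v}" using simple_graph_edgeE[OF assms(3)] by metis
  then show "positive_meas \<Omega> (\<lambda>x. edge_weight U x e)"
    using pair_pos[OF assms(1)] by (simp add: edge_weight_sym[of U, OF assms(2)])
qed

lemma q_component_pos: "positive_meas \<Omega> (\<lambda>x. q (x v))"
  by (rule positive_meas_compose[OF q_pos]) simp

lemma tree_density_pos: "simple_graph T \<Longrightarrow> positive_meas \<Omega> (tree_density T)"
  unfolding tree_density_def[abs_def]
  by (intro meas_intros q_component_pos graph_weight_pos[OF K_pos K_sym])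

lemma tree_density_depends_on: "simple_graph T \<Longrightarrow> depends_on (verts T) (tree_density T)"
  using graph_weight_depends_on[of T K] unfolding depends_on_def tree_density_def
  by (intro allI impI arg_cong2[of _ _ _ _ "(*)"] prod.cong) auto

text \<open>Only the coordinate \<open>v\<close> is redrawn. Neither \<open>h\<close> nor the
  position of \<open>u\<close> changes, and the remaining inner integral is the total mass of the
  transition density.\<close>

lemma integrate_out_leaf:
  assumes h: "bounded_meas \<Omega> h" "depends_on V h" and "u \<in> V" "v \<notin> V"
  shows "(\<integral>x. h x * (q (x v) * K (x u) (x v)) \<partial>\<Omega>) = (\<integral>x. h x \<partial>\<Omega>)"
proof -
  have "bounded_meas \<Omega> (\<lambda>x. h x * (q (x v) * K (x u) (x v)))"
    by (intro meas_intros h(1) positive_meas_bounded q_component_pos pair_pos[OF K_pos])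
  then have "(\<integral>x. h x * (q (x v) * K (x u) (x v)) \<partial>\<Omega>) =
    (\<integral>x. (\<integral>y. h (resample {v} id x y) * (q (resample {v} id x y v) *
      K (resample {v} id x y u) (resample {v} id x y v)) \<partial>\<Omega>) \<partial>\<Omega>)"
    using prob_space_axioms by (intro integral_resample) auto
  also have "\<dots> = (\<integral>x. h x \<partial>\<Omega>)"
  proof (rule Bochner_Integration.integral_cong[OF refl])
    fix x :: "'a \<Rightarrow> real" assume x: "x \<in> space \<Omega>"
    then have xu: "x u \<in> space M" by (rule component_space)
    have meas: "(\<lambda>t. q t * K (x u) t) \<in> borel_measurable M"
      using positive_meas_measurable[OF q_pos] positive_meas_measurable[OF K_pos] xu by measurable
    have "h (resample {v} id x y) = h x" for y
      using assms by (intro depends_onD[OF h(2)]) (auto simp: resample_def)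
    moreover have "resample {v} id x y v = y v" "resample {v} id x y u = x u" for y
      using assms by (auto simp: resample_def)
    ultimately have "(\<integral>y. h (resample {v} id x y) * (q (resample {v} id x y v) *
      K (resample {v} id x y u) (resample {v} id x y v)) \<partial>\<Omega>) = (\<integral>y. h x * (q (y v) * K (x u) (y v)) \<partial>\<Omega>)"
      by simp
    also have "\<dots> = h x * (\<integral>y. q (y v) * K (x u) (y v) \<partial>\<Omega>)" by simp
    also have "(\<integral>y. q (y v) * K (x u) (y v) \<partial>\<Omega>) = (\<integral>t. q t * K (x u) t \<partial>M)"
      by (rule integral_component[OF prob_space_axioms meas])
    finally show "(\<integral>y. h (resample {v} id x y) * (q (resample {v} id x y v) *
      K (resample {v} id x y u) (resample {v} id x y v)) \<partial>\<Omega>) = h x"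
      using K_integral[OF xu] by (simp only: mult_1_right)
  qed
  finally show ?thesis .
qed

lemma tree_density_leaf:
  assumes "simple_graph T" "u \<in> verts T" "v \<notin> verts T"
  shows "tree_density (Graph (insert v (verts T)) (insert {u, v} (edges T))) x
    = tree_density T x * (q (x v) * K (x u) (x v))"
proof -
  have "finite (verts T)" using assms by (simp add: simple_graph_def)
  then show ?thesis
    unfolding tree_density_def graph_weight_def
    using assms finite_edges[OF assms(1)] leaf_edge_fresh[OF assms(1,3)]
    by (simp add: edge_weight_K)
qed

text \<open>While \<open>T'\<close> grows to \<open>T\<close>, every new leaf contributes one factor
  \<open>q (x v) * K (x u) (x v)\<close>; as \<open>h\<close> does not see the leaf, this factor
  integrates out.\<close>

lemma tree_density_marginal:
  assumes "grows T' T" "simple_graph T'" "bounded_meas \<Omega> h" "depends_on (verts T') h"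
  shows "(\<integral>x. tree_density T x * h x \<partial>\<Omega>) = (\<integral>x. tree_density T' x * h x \<partial>\<Omega>)"
  using assms(1)
proof (induction rule: grows.induct)
  case (grow_leaf T u v)
  have T: "simple_graph T" using grows_simple grow_leaf(1) assms(2) .
  have "verts T' \<subseteq> verts T" using grows_subgraph grow_leaf(1) unfolding subgraph_def by blast
  then have dep: "depends_on (verts T) (\<lambda>x. tree_density T x * h x)"
    using tree_density_depends_on[OF T] depends_on_mono[OF assms(4)] unfolding depends_on_def by metis
  have "(\<integral>x. tree_density (Graph (insert v (verts T)) (insert {u, v} (edges T))) x * h x \<partial>\<Omega>)
    = (\<integral>x. (tree_density T x * h x) * (q (x v) * K (x u) (x v)) \<partial>\<Omega>)"
    unfolding tree_density_leaf[OF T grow_leaf(2,3)] by (simp add: ac_simps)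
  also have "\<dots> = (\<integral>x. tree_density T x * h x \<partial>\<Omega>)"
    using grow_leaf(2,3)
    by (intro integrate_out_leaf[OF _ dep] meas_intros positive_meas_bounded tree_density_pos T assms(3))
  finally show ?case using grow_leaf by simp
qed simp

text \<open>Stationarity: \<open>T\<close> grows from any of its vertices, so each vertex has
  marginal density \<open>q\<close>.\<close>

lemma tree_density_vertex_marginal:
  assumes "tree T" "v \<in> verts T" "bounded_meas M k"
  shows "(\<integral>x. tree_density T x * k (x v) \<partial>\<Omega>) = (\<integral>s. q s * k s \<partial>M)"
proof -
  have "(\<integral>x. tree_density T x * k (x v) \<partial>\<Omega>) = (\<integral>x. tree_density (Graph {v} {}) x * k (x v) \<partial>\<Omega>)"
    using assms tree_singleton[of v]
    by (intro tree_density_marginal[OF vertex_grows])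
      (auto simp: tree_def depends_on_def intro: bounded_meas_compose)
  also have "\<dots> = (\<integral>x. q (x v) * k (x v) \<partial>\<Omega>)"
    by (simp add: tree_density_def graph_weight_def)
  also have "\<dots> = (\<integral>s. q s * k s \<partial>M)"
    using positive_meas_measurable[OF q_pos] bounded_meas_measurable[OF assms(3)]
    by (intro integral_component[OF prob_space_axioms]) measurable
  finally show ?thesis .
qed

lemma tree_density_integral: "tree T \<Longrightarrow> (\<integral>x. tree_density T x \<partial>\<Omega>) = 1"
  using tree_density_vertex_marginal[OF _ _ bounded_meas_const, of T _ 1] q_integral
  unfolding tree_def graph_connected_def by auto

section \<open>The entropy inequality\<close>

text \<open>The relative entropy of the stationary distribution with respect to
  \<open>M\<close>.\<close>

definition D :: real where "D = (\<integral>s. q s * ln (q s) \<partial>M)"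

text \<open>Pointwise \<open>q * ln q\<close> is at least \<open>q - 1\<close>, which has integral
  0.\<close>

lemma D_nonneg: "0 \<le> D"
proof -
  have "(\<integral>s. q s - 1 \<partial>M) \<le> (\<integral>s. q s * ln (q s) \<partial>M)"
  proof (rule integral_mono)
    show "integrable M (\<lambda>s. q s - 1)" "integrable M (\<lambda>s. q s * ln (q s))"
      by (intro bounded_meas_integrable meas_intros positive_meas_bounded q_pos)+
    fix s assume "s \<in> space M"
    then have q: "0 < q s" using positive_meas_pos[OF q_pos] by blast
    have "ln (1 / q s) \<le> 1 / q s - 1" using q by (intro ln_le_minus_one) simp
    then have "- ln (q s) \<le> 1 / q s - 1" using q by (simp add: ln_div)
    from mult_left_mono[OF this, of "q s"] show "q s - 1 \<le> q s * ln (q s)"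
      using q by (simp add: algebra_simps)
  qed
  moreover have "(\<integral>s. q s - 1 \<partial>M) = 0"
    using bounded_meas_integrable[OF positive_meas_bounded[OF q_pos]] q_integral prob_space by simp
  ultimately show ?thesis by (simp add: D_def)
qed

text \<open>On each edge \<open>W / K\<close> equals \<open>p\<close> times the values of
  \<open>q\<close> at the two ends. The logarithm thus splits into functions of single vertices, and
  only vertex marginals are needed to integrate it.\<close>

lemma ln_weight_density:
  assumes T: "simple_graph T" and x: "x \<in> space \<Omega>"
  shows "ln (graph_weight W T x / tree_density T x)
    = (\<Sum>e\<in>edges T. ln p + (\<Sum>v\<in>e. ln (q (x v)))) - (\<Sum>v\<in>verts T. ln (q (x v)))"
proof -
  have q: "0 < q (x v)" for v using positive_meas_pos[OF q_component_pos x] .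
  then have q0: "q (x v) \<noteq> 0" for v by (metis less_irrefl)
  have W: "0 < edge_weight W x e" "0 < edge_weight K x e"
    "edge_weight W x e / edge_weight K x e = p * (\<Prod>v\<in>e. q (x v))" if eT: "e \<in> edges T" for e
  proof -
    obtain u v where uv: "u \<noteq> v" and e: "e = {u, v}"
      by (rule simple_graph_edgeE[OF T eT])
    have w: "0 < W (x u) (x v)" "0 < K (x u) (x v)"
      using positive_meas_pos[OF pair_pos[OF W_pos] x] positive_meas_pos[OF pair_pos[OF K_pos] x] .
    show "0 < edge_weight W x e" "0 < edge_weight K x e"
      unfolding e edge_weight_W edge_weight_K by fact+
    have "W (x u) (x v) / K (x u) (x v) = p * (q (x u) * q (x v))"
      unfolding K_def using w(1) by simp
    then show "edge_weight W x e / edge_weight K x e = p * (\<Prod>v\<in>e. q (x v))"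
      unfolding e edge_weight_W edge_weight_K using uv by simp
  qed
  have pq: "0 < p * (\<Prod>v\<in>e. q (x v))" for e using p_pos q by (simp add: prod_pos)
  have "graph_weight W T x / graph_weight K T x = (\<Prod>e\<in>edges T. p * (\<Prod>v\<in>e. q (x v)))"
    unfolding graph_weight_def prod_dividef[symmetric] using W by (intro prod.cong) auto
  then have "graph_weight W T x / tree_density T x
    = (\<Prod>e\<in>edges T. p * (\<Prod>v\<in>e. q (x v))) / (\<Prod>v\<in>verts T. q (x v))"
    unfolding tree_density_def by (metis divide_divide_eq_left mult.commute)
  also have "ln \<dots> = ln (\<Prod>e\<in>edges T. p * (\<Prod>v\<in>e. q (x v))) - ln (\<Prod>v\<in>verts T. q (x v))"
    using pq q by (intro ln_divide_pos) (auto intro: prod_pos)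
  also have "ln (\<Prod>e\<in>edges T. p * (\<Prod>v\<in>e. q (x v))) = (\<Sum>e\<in>edges T. ln (p * (\<Prod>v\<in>e. q (x v))))"
    using finite_edges[OF T] pq by (intro ln_prod) (auto simp: less_le)
  also have "\<dots> = (\<Sum>e\<in>edges T. ln p + (\<Sum>v\<in>e. ln (q (x v))))"
  proof (rule sum.cong[OF refl])
    fix e assume "e \<in> edges T"
    then have "finite e" using simple_graph_edgeE[OF T] by (metis finite.emptyI finite_insert)
    then show "ln (p * (\<Prod>v\<in>e. q (x v))) = ln p + (\<Sum>v\<in>e. ln (q (x v)))"
      using p_pos q q0 by (simp add: ln_mult_pos prod_pos ln_prod)
  qed
  also have "ln (\<Prod>v\<in>verts T. q (x v)) = (\<Sum>v\<in>verts T. ln (q (x v)))"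
    using q0 T by (intro ln_prod) (auto simp: simple_graph_def)
  finally show ?thesis .
qed

text \<open>Each edge contributes \<open>ln p + 2 * D\<close> and each vertex removes
  \<open>D\<close>. With one more vertex than edges, \<open>D\<close> is left with coefficient
  \<open>2e - (e + 1) = e - 1\<close>, where \<open>e\<close> is the number of edges.\<close>

lemma ln_weight_density_integral:
  assumes T: "tree T"
  shows "(\<integral>x. tree_density T x * ln (graph_weight W T x / tree_density T x) \<partial>\<Omega>)
    = card (edges T) * ln p + (real (card (edges T)) - 1) * D"
proof -
  have sT: "simple_graph T" using T by (simp add: tree_def)
  let ?L = "\<lambda>v x. tree_density T x * ln (q (x v))"
  have L: "integrable \<Omega> (?L v)" for v
    by (intro integrable_\<Omega> meas_intros positive_meas_bounded tree_density_pos sT q_component_pos)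
  have d: "integrable \<Omega> (tree_density T)"
    by (intro integrable_\<Omega> positive_meas_bounded tree_density_pos sT)
  have LD: "(\<integral>x. ?L v x \<partial>\<Omega>) = D" if "v \<in> verts T" for v
    unfolding D_def by (intro tree_density_vertex_marginal[OF T that] meas_intros q_pos)
  have "(\<integral>x. tree_density T x * ln (graph_weight W T x / tree_density T x) \<partial>\<Omega>)
    = (\<integral>x. (\<Sum>e\<in>edges T. tree_density T x * ln p + (\<Sum>v\<in>e. ?L v x)) - (\<Sum>v\<in>verts T. ?L v x) \<partial>\<Omega>)"
    by (intro Bochner_Integration.integral_cong[OF refl])
      (simp add: ln_weight_density[OF sT] right_diff_distrib distrib_left sum_distrib_left)
  also have "\<dots> = (\<Sum>e\<in>edges T. (\<integral>x. tree_density T x \<partial>\<Omega>) * ln p + (\<Sum>v\<in>e. \<integral>x. ?L v x \<partial>\<Omega>))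
      - (\<Sum>v\<in>verts T. \<integral>x. ?L v x \<partial>\<Omega>)"
    using L d by (simp add: Bochner_Integration.integral_sum Bochner_Integration.integral_diff
      Bochner_Integration.integral_add Bochner_Integration.integrable_sum)
  also have "(\<Sum>v\<in>verts T. \<integral>x. ?L v x \<partial>\<Omega>) = card (verts T) * D"
    using LD by simp
  also have "(\<Sum>e\<in>edges T. (\<integral>x. tree_density T x \<partial>\<Omega>) * ln p + (\<Sum>v\<in>e. \<integral>x. ?L v x \<partial>\<Omega>))
    = (\<Sum>e\<in>edges T. ln p + 2 * D)"
  proof (rule sum.cong[OF refl])
    fix e assume "e \<in> edges T"
    then obtain u v where "e = {u, v}" "u \<noteq> v" "u \<in> verts T" "v \<in> verts T"
      using simple_graph_edgeE[OF sT] by metis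
    then show "(\<integral>x. tree_density T x \<partial>\<Omega>) * ln p + (\<Sum>v\<in>e. \<integral>x. ?L v x \<partial>\<Omega>) = ln p + 2 * D"
      using LD tree_density_integral[OF T] by simp
  qed
  finally show ?thesis
    using card_verts_tree[OF T] by (simp add: algebra_simps)
qed

text \<open>Gibbs' inequality: \<open>graph_weight W T / c\<close> is a subprobability density, so the entropy of
  \<open>tree_density T\<close> relative to it is nonnegative.\<close>

lemma entropy_inequality:
  assumes T: "tree T" "edges T \<noteq> {}" and c: "positive_meas \<Omega> c"
    and le: "(\<integral>x. graph_weight W T x / c x \<partial>\<Omega>) \<le> 1"
  shows "card (edges T) * ln p \<le> (\<integral>x. tree_density T x * ln (c x) \<partial>\<Omega>)"
proof -
  have sT: "simple_graph T" using T by (simp add: tree_def)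
  note pos = tree_density_pos[OF sT] graph_weight_pos[OF W_pos W_sym sT]
  let ?L = "\<lambda>x. tree_density T x * ln (graph_weight W T x / tree_density T x)"
  have int: "integrable \<Omega> ?L" "integrable \<Omega> (tree_density T)" "integrable \<Omega> (\<lambda>x. graph_weight W T x / c x)"
    "integrable \<Omega> (\<lambda>x. tree_density T x * ln (c x))"
    by (intro integrable_\<Omega> bounded_meas_mult bounded_meas_ln positive_meas_bounded positive_meas_divide pos c)+
  have "(\<integral>x. ?L x + (tree_density T x - graph_weight W T x / c x) \<partial>\<Omega>)
    \<le> (\<integral>x. tree_density T x * ln (c x) \<partial>\<Omega>)"
  proof (rule integral_mono)
    show "integrable \<Omega> (\<lambda>x. ?L x + (tree_density T x - graph_weight W T x / c x))"
      using int by (intro Bochner_Integration.integrable_add Bochner_Integration.integrable_diff)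
    show "integrable \<Omega> (\<lambda>x. tree_density T x * ln (c x))" by fact
    fix x :: "'a \<Rightarrow> real" assume x: "x \<in> space \<Omega>"
    let ?f = "tree_density T x" and ?w = "graph_weight W T x"
    have f: "0 < ?f" "0 < ?w" "0 < c x"
      using positive_meas_pos[OF _ x] pos c by blast+
    \<comment> \<open>Multiplied by the density \<open>?f\<close>, the tangent bound
      \<open>ln y \<le> y - 1\<close> at \<open>y = ?w / (?f * c x)\<close> becomes the pointwise
      estimate.\<close>
    have "ln (?w / ?f / c x) \<le> ?w / ?f / c x - 1" using f by (intro ln_le_minus_one) simp
    moreover have "ln (?w / ?f / c x) = ln (?w / ?f) - ln (c x)" using f
      by (intro ln_divide_pos) auto
    ultimately have "ln (?w / ?f) - ln (c x) \<le> ?w / ?f / c x - 1" by simp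
    from mult_left_mono[OF this, of ?f] show "?L x + (?f - ?w / c x) \<le> ?f * ln (c x)"
      using f by (simp add: algebra_simps)
  qed
  moreover have "(\<integral>x. ?L x + (tree_density T x - graph_weight W T x / c x) \<partial>\<Omega>)
      = (\<integral>x. ?L x \<partial>\<Omega>) + (1 - (\<integral>x. graph_weight W T x / c x \<partial>\<Omega>))"
    using int tree_density_integral[OF T(1)] by simp
  moreover have "1 \<le> card (edges T)"
    using T(2) finite_edges[OF sT] by (simp add: Suc_le_eq card_gt_0_iff)
  then have "0 \<le> (real (card (edges T)) - 1) * D" using D_nonneg by (intro mult_nonneg_nonneg) auto
  ultimately show ?thesis using le ln_weight_density_integral[OF T(1)] by linarith
qed

text \<open>\<open>g\<close> is the weight of \<open>T'\<close> with the vertices outside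
  \<open>S\<close> integrated out. Dividing by it turns the weight of \<open>T'\<close> into a
  conditional density given the positions of \<open>S\<close>, of total mass 1, so
  \<open>entropy_inequality\<close> applies with \<open>c = g\<close>.\<close>

lemma ln_conditional_weight:
  fixes T' :: "'a ugraph" and S :: "'a set"
  assumes T': "tree T'"
  defines "g \<equiv> \<lambda>x. \<integral>y. graph_weight W T' (resample (- S) id x y) \<partial>\<Omega>"
  shows "positive_meas \<Omega> g" and "depends_on S g"
    and "card (edges T') * ln p \<le> (\<integral>x. tree_density T' x * ln (g x) \<partial>\<Omega>)"
proof -
  interpret O: prob_space "\<Omega> :: ('a \<Rightarrow> real) measure" by (rule \<Omega>_prob)
  have sT': "simple_graph T'" using T' by (simp add: tree_def)
  note w = graph_weight_pos[OF W_pos W_sym sT']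
  have "positive_meas (\<Omega> \<Otimes>\<^sub>M \<Omega>) (\<lambda>(x, y). graph_weight W T' (resample (- S) id x y))"
    using positive_meas_compose[OF w measurable_resample[of "- S" id]] by (simp add: split_beta')
  then show g: "positive_meas \<Omega> g"
    unfolding g_def by (rule O.positive_meas_integral)
  have g_dep: "depends_on S g"
    unfolding depends_on_def
  proof (intro allI impI)
    fix x y :: "'a \<Rightarrow> real" assume "\<forall>v\<in>S. x v = y v"
    then have "resample (- S) id x = resample (- S) id y"
      by (auto simp: resample_def fun_eq_iff)
    then show "g x = g y" by (simp only: g_def)
  qed
  then show "depends_on S g" .
  show "card (edges T') * ln p \<le> (\<integral>x. tree_density T' x * ln (g x) \<partial>\<Omega>)"
  \<comment> \<open>\<open>T'\<close> may be a single vertex, which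
    \<open>entropy_inequality\<close> excludes; then \<open>g\<close> is constantly 1.\<close>
  proof (cases "edges T' = {}")
    case True
    then have "g x = 1" for x using O.prob_space by (simp add: g_def graph_weight_def)
    then show ?thesis using True by simp
  next
    case False
    have "(\<integral>x. graph_weight W T' x / g x \<partial>\<Omega>)
      = (\<integral>x. (\<integral>y. graph_weight W T' (resample (- S) id x y) / g (resample (- S) id x y) \<partial>\<Omega>) \<partial>\<Omega>)"
      by (intro integral_resample prob_space_axioms positive_meas_bounded positive_meas_divide w g) simp
    also have "\<dots> = (\<integral>x. 1 \<partial>(\<Omega> :: ('a \<Rightarrow> real) measure))"
    proof (rule Bochner_Integration.integral_cong[OF refl])
      fix x :: "'a \<Rightarrow> real" assume x: "x \<in> space \<Omega>"
      \<comment> \<open>\<open>g\<close> sees only \<open>S\<close>, which is not redrawn, so the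
        inner integral is \<open>g x / g x\<close>.\<close>
      have "g (resample (- S) id x y) = g x" for y
        by (rule depends_onD[OF g_dep]) (simp add: resample_def)
      then show "(\<integral>y. graph_weight W T' (resample (- S) id x y) / g (resample (- S) id x y) \<partial>\<Omega>) = 1"
        using positive_meas_pos[OF g x] g_def[THEN meta_eq_to_obj_eq, THEN fun_cong, of x] by simp
    qed
    also have "\<dots> = 1" using O.prob_space by simp
    finally show ?thesis by (intro entropy_inequality[OF T' False g]) simp
  qed
qed

text \<open>The test function \<open>h\<close> makes the induction work: integrating the new
  vertices out of the weight of \<open>G'\<close> leaves the weight of \<open>G\<close> times
  \<open>g\<close>. Since \<open>ln g\<close> depends only on \<open>S\<close>, a set of vertices of
  \<open>T\<close>, the induction hypothesis may be used at \<open>h + ln g\<close>.\<close>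

lemma reflections_ln_weight:
  assumes "reflections T G" and T: "tree T" "edges T \<noteq> {}"
    and "bounded_meas \<Omega> h" "depends_on (verts T) h"
  shows "card (edges G) * ln p + (\<integral>x. tree_density T x * h x \<partial>\<Omega>)
    \<le> ln (\<integral>x. graph_weight W G x * exp (h x) \<partial>\<Omega>)"
  using assms(1,4,5)
proof (induction arbitrary: h rule: reflections.induct)
  case (base h)
  interpret O: prob_space "\<Omega> :: ('a \<Rightarrow> real) measure" by (rule \<Omega>_prob)
  have sT: "simple_graph T" using T by (simp add: tree_def)
  note w = graph_weight_pos[OF W_pos W_sym sT]
  \<comment> \<open>The normalisation for which \<open>c = C / exp h\<close> satisfies the
    hypothesis of \<open>entropy_inequality\<close> with equality.\<close>
  define C where "C = (\<integral>x. graph_weight W T x * exp (h x) \<partial>\<Omega>)"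
  have C: "0 < C"
    unfolding C_def
    by (intro O.positive_meas_integral_pos positive_meas_mult positive_meas_exp w base(1))
  have "(\<integral>x. graph_weight W T x / (C / exp (h x)) \<partial>\<Omega>) = (\<integral>x. graph_weight W T x * exp (h x) / C \<partial>\<Omega>)"
    by simp
  also have "\<dots> = 1" using C by (simp flip: C_def)
  finally have "card (edges T) * ln p \<le> (\<integral>x. tree_density T x * ln (C / exp (h x)) \<partial>\<Omega>)"
    using C base(1) by (intro entropy_inequality[OF T] meas_intros) auto
  also have "\<dots> = (\<integral>x. tree_density T x * ln C - tree_density T x * h x \<partial>\<Omega>)"
    using C by (simp add: ln_div right_diff_distrib)
  also have "\<dots> = ln C - (\<integral>x. tree_density T x * h x \<partial>\<Omega>)"
  proof -
    have "integrable \<Omega> (tree_density T)" "integrable \<Omega> (\<lambda>x. tree_density T x * h x)"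
      by (intro integrable_\<Omega> bounded_meas_mult positive_meas_bounded tree_density_pos sT base(1))+
    then show ?thesis using tree_density_integral[OF T(1)] by simp
  qed
  finally show ?case unfolding C_def by simp
next
  case (reflect G T' S G' h)
  have SG: "simple_graph G" and VG: "verts T \<subseteq> verts G"
    using reflections_invariant[OF reflect.hyps(1) T(1)] by blast+
  obtain \<phi> where \<phi>: "reflection_step G T' S \<phi>" "G' = reflection_step.reflected G T' \<phi>"
    using is_reflectionE[OF reflect.hyps(6) SG VG reflect.hyps(2-5)] by blast
  interpret R: reflection_step G T' S \<phi> by fact
  define g where "g = (\<lambda>x. \<integral>y. graph_weight W T' (resample (- S) id x y) \<partial>\<Omega>)"
  have g: "positive_meas \<Omega> g" "depends_on S g"
      "card (edges T') * ln p \<le> (\<integral>x. tree_density T' x * ln (g x) \<partial>\<Omega>)"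
    using ln_conditional_weight[OF reflect.hyps(2), of S] unfolding g_def by blast+
  have sT: "simple_graph T" using T by (simp add: tree_def)
  have ST: "S \<subseteq> verts T" using reflect.hyps(5) by (simp add: independent_set_def)
  have lng: "depends_on S (\<lambda>x. ln (g x))" using g(2) unfolding depends_on_def by metis
  \<comment> \<open>Here it matters that \<open>T'\<close> is a subtree of the initial tree: its
    density is then a marginal of that of \<open>T\<close>, so the bound for \<open>T'\<close>
    carries over.\<close>
  have "(\<integral>x. tree_density T x * ln (g x) \<partial>\<Omega>) = (\<integral>x. tree_density T' x * ln (g x) \<partial>\<Omega>)"
    using depends_on_mono[OF lng reflect.hyps(4)] R.T'
    by (intro tree_density_marginal[OF subtree_grows[OF reflect.hyps(2) T(1) reflect.hyps(3)]] meas_intros g(1)) auto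
  then have marg: "card (edges T') * ln p \<le> (\<integral>x. tree_density T x * ln (g x) \<partial>\<Omega>)" using g(3) by simp
  have "card (edges G) * ln p + (\<integral>x. tree_density T x * (h x + ln (g x)) \<partial>\<Omega>)
      \<le> ln (\<integral>x. graph_weight W G x * exp (h x + ln (g x)) \<partial>\<Omega>)"
  proof (rule reflect.IH)
    show "bounded_meas \<Omega> (\<lambda>x. h x + ln (g x))" by (intro meas_intros g(1) reflect.prems(1))
    show "depends_on (verts T) (\<lambda>x. h x + ln (g x))"
      using depends_on_mono[OF lng ST] reflect.prems(2) unfolding depends_on_def by metis
  qed
  moreover have "(\<integral>x. tree_density T x * (h x + ln (g x)) \<partial>\<Omega>)
      = (\<integral>x. tree_density T x * h x \<partial>\<Omega>) + (\<integral>x. tree_density T x * ln (g x) \<partial>\<Omega>)"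
  proof -
    have "integrable \<Omega> (\<lambda>x. tree_density T x * h x)" "integrable \<Omega> (\<lambda>x. tree_density T x * ln (g x))"
      by (intro integrable_\<Omega> bounded_meas_mult bounded_meas_ln positive_meas_bounded tree_density_pos sT g(1) reflect.prems(1))+
    then show ?thesis by (simp add: distrib_left)
  qed
  moreover have "(\<integral>x. graph_weight W G x * exp (h x + ln (g x)) \<partial>\<Omega>)
      = (\<integral>x. graph_weight W G' x * exp (h x) \<partial>\<Omega>)"
  proof -
    \<comment> \<open>\<open>N\<close> consists of the new vertices and \<psi> sends each back to
      its original, as \<open>graph_weight_resample\<close> requires.\<close>
    define N where "N = \<phi> ` (verts T' - S)"
    define \<psi> where "\<psi> = the_inv_into (verts T') \<phi>"
    have "inj_on \<psi> N"
      unfolding N_def \<psi>_def by (rule inj_on_subset[OF inj_on_the_inv_into[OF R.inj]]) auto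
    then have "(\<integral>x. graph_weight W G' x * exp (h x) \<partial>\<Omega>) = (\<integral>x. (\<integral>y. graph_weight W G' (resample N \<psi> x y)
        * exp (h (resample N \<psi> x y)) \<partial>\<Omega>) \<partial>\<Omega>)"
      using \<phi>(2) R.simple_reflected
      by (intro integral_resample prob_space_axioms positive_meas_bounded positive_meas_mult
        positive_meas_exp graph_weight_pos W_pos W_sym reflect.prems(1)) auto
    also have "\<dots> = (\<integral>x. graph_weight W G x * exp (h x + ln (g x)) \<partial>\<Omega>)"
    proof (rule Bochner_Integration.integral_cong[OF refl])
      fix x :: "'a \<Rightarrow> real" assume x: "x \<in> space \<Omega>"
      \<comment> \<open>\<open>h\<close> sees only vertices of \<open>T\<close>, which all lie in
        \<open>G\<close>, whereas \<open>N\<close> is disjoint from \<open>G\<close>.\<close>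
      have "h (resample N \<psi> x y) = h x" for y
        by (rule depends_onD[OF reflect.prems(2)])
          (use R.fresh VG in \<open>auto simp: resample_def N_def\<close>)
      then have "(\<integral>y. graph_weight W G' (resample N \<psi> x y) * exp (h (resample N \<psi> x y)) \<partial>\<Omega>)
        = (\<integral>y. graph_weight W G x * exp (h x) * graph_weight W T' (resample (- S) id x y) \<partial>\<Omega>)"
        using R.graph_weight_resample[OF W_sym N_def \<psi>_def] \<phi>(2) by (simp add: ac_simps)
      also have "\<dots> = graph_weight W G x * exp (h x) * g x" unfolding g_def by simp
      finally show "(\<integral>y. graph_weight W G' (resample N \<psi> x y) * exp (h (resample N \<psi> x y)) \<partial>\<Omega>)
        = graph_weight W G x * exp (h x + ln (g x))"
        using positive_meas_pos[OF g(1) x] by (simp add: exp_add)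
    qed
    finally show ?thesis by simp
  qed
  moreover have "card (edges G') = card (edges G) + card (edges T')"
    using R.card_edges_reflected \<phi>(2) by simp
  ultimately show ?case using marg by (simp add: algebra_simps)
qed

text \<open>The case \<open>h = 0\<close>, exponentiated. If \<open>T\<close> has no edge, no
  reflection creates one and both sides are 1.\<close>

lemma reflections_weight:
  assumes "reflections T G" "tree T"
  shows "p ^ card (edges G) \<le> (\<integral>x. graph_weight W G x \<partial>\<Omega>)"
proof (cases "edges T = {}")
  case True
  interpret O: prob_space "\<Omega> :: ('a \<Rightarrow> real) measure" by (rule \<Omega>_prob)
  show ?thesis using reflections_edgeless[OF assms(1) True] O.prob_space
    by (simp add: graph_weight_def)
next
  case False
  interpret O: prob_space "\<Omega> :: ('a \<Rightarrow> real) measure" by (rule \<Omega>_prob)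
  have "simple_graph G" using reflections_invariant[OF assms] by blast
  then have pos: "0 < (\<integral>x. graph_weight W G x \<partial>\<Omega>)"
    by (intro O.positive_meas_integral_pos graph_weight_pos W_pos W_sym)
  have "card (edges G) * ln p \<le> ln (\<integral>x. graph_weight W G x \<partial>\<Omega>)"
    using reflections_ln_weight[OF assms False bounded_meas_const[of _ 0]]
    by (simp add: depends_on_def)
  then have "ln (p ^ card (edges G)) \<le> ln (\<integral>x. graph_weight W G x \<partial>\<Omega>)"
    using p_pos by (simp add: ln_realpow)
  then show ?thesis using pos p_pos by (subst (asm) ln_le_cancel_iff) auto
qed

end

section \<open>Lebesgue measurable graphons\<close>

abbreviation unit_measure :: "real measure" where
  "unit_measure \<equiv> restrict_space lborel {0..1}"

lemma prob_space_unit: "prob_space unit_measure"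
  by (rule prob_space_restrict_space) auto

lemma product_prob_space_unit: "product_prob_space (\<lambda>_. unit_measure)"
  by (rule product_prob_spaceI) (rule prob_space_unit)

lemma ident_unit_borel: "(\<lambda>x. x) \<in> borel_measurable unit_measure"
  by (intro measurable_restrict_space1) simp

lemma unit_square_sets: "{0..1} \<times> {0..1} \<in> sets (borel :: (real \<times> real) measure)"
  unfolding borel_prod[symmetric] by (intro pair_measureI) auto

text \<open>The identity is measurable in both directions, so the sigma-algebras coincide; the
  measures agree on rectangles. This links the product measure to the planar Lebesgue measure in
  \<open>graphon\<close>.\<close>

lemma pair_unit_eq: "unit_measure \<Otimes>\<^sub>M unit_measure = restrict_space lborel ({0..1} \<times> {0..1})"
proof (rule pair_measure_eqI)
  interpret prob_space unit_measure by (rule prob_space_unit)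
  show "sigma_finite_measure unit_measure" "sigma_finite_measure unit_measure" by unfold_locales
  let ?Q = "{0..1} \<times> {0..1} :: (real \<times> real) set"
  let ?P = "unit_measure \<Otimes>\<^sub>M unit_measure"
  have sp: "space ?P = ?Q" "space (restrict_space lborel ?Q) = ?Q"
    by (auto simp: space_pair_measure space_restrict_space)
  have fs: "(\<lambda>z. fst z) \<in> borel_measurable ?P" "(\<lambda>z. snd z) \<in> borel_measurable ?P"
    by (auto intro: measurable_compose[OF _ ident_unit_borel])
  then have "(\<lambda>z. (fst z, snd z)) \<in> borel_measurable ?P" by (rule borel_measurable_Pair)
  then have 1: "(\<lambda>z. z) \<in> measurable ?P (restrict_space lborel ?Q)"
    by (intro measurable_restrict_space2) (auto simp: sp)
  have "fst \<in> borel_measurable (borel :: (real \<times> real) measure)"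
    "snd \<in> borel_measurable (borel :: (real \<times> real) measure)"
    by (auto simp: borel_prod[symmetric])
  then have "fst \<in> borel_measurable (restrict_space lborel ?Q)"
    "snd \<in> borel_measurable (restrict_space lborel ?Q)"
    by (auto intro!: measurable_restrict_space1)
  then have "fst \<in> measurable (restrict_space lborel ?Q) unit_measure"
    "snd \<in> measurable (restrict_space lborel ?Q) unit_measure"
    by (auto intro!: measurable_restrict_space2 simp: space_restrict_space)
  then have "(\<lambda>z. (fst z, snd z)) \<in> measurable (restrict_space lborel ?Q) ?P"
    by (rule measurable_Pair)
  then have 2: "(\<lambda>z. z) \<in> measurable (restrict_space lborel ?Q) ?P" by simp
  show "sets ?P = sets (restrict_space lborel ?Q)"
  proof (intro set_eqI iffI)
    fix X assume X: "X \<in> sets ?P"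
    then have "X \<subseteq> ?Q" using sets.sets_into_space sp by metis
    then show "X \<in> sets (restrict_space lborel ?Q)"
      using measurable_sets[OF 2 X] sp by (simp add: Int_absorb2)
  next
    fix X assume X: "X \<in> sets (restrict_space lborel ?Q)"
    then have "X \<subseteq> ?Q" using sets.sets_into_space sp by metis
    then show "X \<in> sets ?P"
      using measurable_sets[OF 1 X] sp by (simp add: Int_absorb2)
  qed
  fix A B assume AB: "A \<in> sets unit_measure" "B \<in> sets unit_measure"
  then have "A \<in> sets lborel" "B \<in> sets lborel" "A \<subseteq> {0..1}" "B \<subseteq> {0..1}"
    by (auto simp: sets_restrict_space_iff)
  moreover from this have "emeasure (restrict_space lborel ?Q) (A \<times> B) = emeasure (lborel \<Otimes>\<^sub>M lborel) (A \<times> B)"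
    unfolding lborel_prod using unit_square_sets by (intro emeasure_restrict_space) auto
  ultimately show "emeasure unit_measure A * emeasure unit_measure B = emeasure (restrict_space lborel ?Q) (A \<times> B)"
    by (simp add: emeasure_restrict_space lborel.emeasure_pair_measure_Times)
qed

text \<open>Distinct coordinates are independent. This carries almost-everywhere statements on the
  square over to the endpoints of an edge.\<close>

lemma distr_pair_component:
  fixes M :: "'b measure"
  assumes "prob_space M" "u \<in> I" "v \<in> I" "u \<noteq> v"
  shows "distr (Pi\<^sub>M I (\<lambda>_. M)) (M \<Otimes>\<^sub>M M) (\<lambda>x. (x u, x v)) = M \<Otimes>\<^sub>M M"
proof (rule pair_measure_eqI[symmetric])
  interpret prob_space M by fact
  interpret P: product_prob_space "\<lambda>_. M" I by unfold_locales
  show "sigma_finite_measure M" "sigma_finite_measure M" by unfold_locales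
  fix A B assume AB: "A \<in> sets M" "B \<in> sets M"
  let ?X = "\<lambda>i. if i = u then A else B"
  have "(\<lambda>x. (x u, x v)) -` (A \<times> B) \<inter> space (Pi\<^sub>M I (\<lambda>_. M))
    = {x \<in> space (Pi\<^sub>M I (\<lambda>_. M)). \<forall>i\<in>{u, v}. x i \<in> ?X i}"
    using assms by auto
  moreover have "(\<lambda>x. (x u, x v)) \<in> measurable (Pi\<^sub>M I (\<lambda>_. M)) (M \<Otimes>\<^sub>M M)"
    using assms by (intro measurable_Pair measurable_component_singleton)
  ultimately have "emeasure (distr (Pi\<^sub>M I (\<lambda>_. M)) (M \<Otimes>\<^sub>M M) (\<lambda>x. (x u, x v))) (A \<times> B)
    = emeasure (Pi\<^sub>M I (\<lambda>_. M)) {x \<in> space (Pi\<^sub>M I (\<lambda>_. M)). \<forall>i\<in>{u, v}. x i \<in> ?X i}"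
    using AB by (simp add: emeasure_distr)
  also have "\<dots> = (\<Prod>i\<in>{u, v}. emeasure M (?X i))"
    using assms AB by (intro P.emeasure_PiM_Collect) auto
  finally show "emeasure M A * emeasure M B
    = emeasure (distr (Pi\<^sub>M I (\<lambda>_. M)) (M \<Otimes>\<^sub>M M) (\<lambda>x. (x u, x v))) (A \<times> B)"
    using assms by simp
qed simp

text \<open>A graphon is only Lebesgue measurable, and symmetric with values in the unit interval
  only on the square. \<open>U\<close> has these properties everywhere and is Borel, so it composes
  with coordinate maps of product spaces; it matches \<open>W\<close> up to a null set.\<close>

definition borel_version :: "(real \<Rightarrow> real \<Rightarrow> real) \<Rightarrow> (real \<Rightarrow> real \<Rightarrow> real) \<Rightarrow> bool" where
  "borel_version W U \<longleftrightarrow> (\<lambda>(s, t). U s t) \<in> borel_measurable borel \<and>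
    (\<forall>s t. U s t = U t s) \<and> (\<forall>s t. 0 \<le> U s t \<and> U s t \<le> 1) \<and>
    (AE z in lborel. z \<in> {0..1} \<times> {0..1} \<longrightarrow> W (fst z) (snd z) = U (fst z) (snd z))"

text \<open>Planar Lebesgue measure is invariant under reflection in the diagonal.\<close>

lemma AE_lborel_swap:
  assumes "AE z in (lborel :: (real \<times> real) measure). P z"
  shows "AE z in lborel. P (snd z, fst z)"
proof -
  have swap: "distr (lborel \<Otimes>\<^sub>M lborel) (lborel \<Otimes>\<^sub>M lborel) (\<lambda>(x, y). (y, x)) = (lborel \<Otimes>\<^sub>M lborel :: (real \<times> real) measure)"
    by (rule lborel_pair.distr_pair_swap[symmetric])
  have "AE z in distr (lborel \<Otimes>\<^sub>M lborel) (lborel \<Otimes>\<^sub>M lborel) (\<lambda>(x :: real, y :: real). (y, x)). P z"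
    by (subst swap, subst lborel_prod) (rule assms)
  then have "AE z in (lborel \<Otimes>\<^sub>M lborel). P (case z of (x, y) \<Rightarrow> (y, x))"
    by (rule AE_distrD[OF measurable_pair_swap'])
  then show ?thesis by (subst lborel_prod[symmetric]) (simp add: split_beta')
qed

lemma borel_version_exists:
  assumes W: "graphon W"
  obtains U where "borel_version W U"
proof -
  let ?Q = "{0..1} \<times> {0..1} :: (real \<times> real) set"
  define f where "f z = (if z \<in> ?Q then W (fst z) (snd z) else 0)" for z
  have "(\<lambda>z. W (fst z) (snd z)) \<in> borel_measurable (lebesgue_on ?Q)"
    using W unfolding graphon_def by (simp add: split_beta')
  moreover have "?Q \<in> sets lebesgue" using unit_square_sets by (intro sets_completionI_sets) simp
  ultimately have "f \<in> borel_measurable lebesgue"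
    unfolding f_def by (subst borel_measurable_if) auto
  then obtain g where g: "g \<in> borel_measurable lborel" "AE z in lborel. f z = g z"
    using completion_ex_borel_measurable_real by blast
  have g2: "(\<lambda>z. g (snd z, fst z)) \<in> borel_measurable borel"
    using g(1) by (intro measurable_compose[of "\<lambda>z. (snd z, fst z)" borel borel g])
      (auto intro!: borel_measurable_Pair simp: borel_prod[symmetric])
  \<comment> \<open>Averaging over the swap forces symmetry and clipping forces values in the unit
    interval. At a point of the square where \<open>f\<close> and \<open>g\<close> agree there and
    at the mirror image, neither changes the value of \<open>W\<close>.\<close>
  define U where "U s t = max 0 (min 1 ((g (s, t) + g (t, s)) / 2))" for s t
  have "borel_version W U"
    unfolding borel_version_def
  proof (intro conjI allI)
    show "(\<lambda>(s, t). U s t) \<in> borel_measurable borel"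
      unfolding U_def split_beta' using g(1) g2
      by (auto intro!: borel_measurable_max borel_measurable_min)
    show "U s t = U t s" for s t unfolding U_def by (simp add: add.commute)
    show "0 \<le> U s t" "U s t \<le> 1" for s t unfolding U_def by auto
    show "AE z in lborel. z \<in> ?Q \<longrightarrow> W (fst z) (snd z) = U (fst z) (snd z)"
      using g(2) AE_lborel_swap[OF g(2)]
    proof eventually_elim
      fix z :: "real \<times> real"
      assume *: "f z = g z" "f (snd z, fst z) = g (snd z, fst z)"
      show "z \<in> ?Q \<longrightarrow> W (fst z) (snd z) = U (fst z) (snd z)"
      proof
        assume z: "z \<in> ?Q"
        then have "0 \<le> W (fst z) (snd z)" "W (fst z) (snd z) \<le> 1" "W (snd z) (fst z) = W (fst z) (snd z)"
          using W unfolding graphon_def by auto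
        then show "W (fst z) (snd z) = U (fst z) (snd z)"
          using * z by (auto simp: f_def U_def mem_Times_iff)
      qed
    qed
  qed
  then show ?thesis by (rule that)
qed

text \<open>Preimages under \<open>f\<close> and \<open>g\<close> differ by a subset of a null set,
  which is measurable by completeness.\<close>

lemma (in complete_measure) borel_measurable_cong_AE:
  fixes f g :: "'a \<Rightarrow> 'b::topological_space"
  assumes f: "f \<in> borel_measurable M" and ae: "AE x in M. f x = g x"
  shows "g \<in> borel_measurable M"
proof (rule measurableI)
  fix A :: "'b set" assume "A \<in> sets borel"
  then have A: "f -` A \<inter> space M \<in> sets M" by (rule measurable_sets[OF f])
  show "g -` A \<inter> space M \<in> sets M"
    by (rule in_sets_AE[OF _ A]) (use ae in \<open>auto elim: eventually_mono\<close>)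
qed simp

section \<open>Integrals of a graphon and of its Borel version\<close>

context
  fixes W U :: "real \<Rightarrow> real \<Rightarrow> real"
  assumes W: "graphon W" and U: "borel_version W U"
begin

lemma U_sym: "U s t = U t s" and U_nonneg: "0 \<le> U s t" and U_le_1: "U s t \<le> 1"
  using U unfolding borel_version_def by blast+

lemma U_measurable: "(\<lambda>(s, t). U s t) \<in> borel_measurable (unit_measure \<Otimes>\<^sub>M unit_measure)"
  using U unfolding borel_version_def pair_unit_eq by (intro measurable_restrict_space1) simp

lemma U_pair_measurable: "u \<in> I \<Longrightarrow> v \<in> I \<Longrightarrow>
    (\<lambda>x. U (x u) (x v)) \<in> borel_measurable (Pi\<^sub>M I (\<lambda>_. unit_measure))"
  using measurable_compose[OF _ U_measurable, of "\<lambda>x. (x u, x v)" "Pi\<^sub>M I (\<lambda>_. unit_measure)"]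
  by (simp add: measurable_Pair measurable_component_singleton)

lemma AE_pair_unit: "AE z in unit_measure \<Otimes>\<^sub>M unit_measure. W (fst z) (snd z) = U (fst z) (snd z)"
proof -
  have "AE z in lborel. z \<in> {0..1} \<times> {0..1} \<longrightarrow> W (fst z) (snd z) = U (fst z) (snd z)"
    using U unfolding borel_version_def by blast
  then show ?thesis unfolding pair_unit_eq
    by (subst AE_restrict_space_iff) (use unit_square_sets in \<open>auto\<close>)
qed

lemma lebesgue_integral_eq:
  "(\<integral>(x, y). W x y \<partial>(lebesgue_on ({0..1} \<times> {0..1})))
    = (\<integral>(x, y). U x y \<partial>(unit_measure \<Otimes>\<^sub>M unit_measure))"
proof -
  let ?Q = "{0..1} \<times> {0..1} :: (real \<times> real) set"
  have QL: "?Q \<in> sets lebesgue" using unit_square_sets by (intro sets_completionI_sets) simp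
  have Um: "(\<lambda>z. case z of (s, t) \<Rightarrow> U s t) \<in> borel_measurable lborel"
    using U unfolding borel_version_def by simp
  have ae: "AE z in lebesgue. z \<in> ?Q \<longrightarrow> W (fst z) (snd z) = U (fst z) (snd z)"
    using U unfolding borel_version_def by (intro AE_completion) blast
  have "(\<integral>(x, y). W x y \<partial>(lebesgue_on ?Q)) = (\<integral>(x, y). U x y \<partial>(lebesgue_on ?Q))"
  proof (rule integral_cong_AE)
    show "(\<lambda>(x, y). W x y) \<in> borel_measurable (lebesgue_on ?Q)"
      using W unfolding graphon_def by blast
    show "(\<lambda>(x, y). U x y) \<in> borel_measurable (lebesgue_on ?Q)"
      using Um by (intro measurable_restrict_space1 measurable_completion)
    show "AE z in lebesgue_on ?Q. (case z of (x, y) \<Rightarrow> W x y) = (case z of (x, y) \<Rightarrow> U x y)"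
      using ae by (subst AE_restrict_space_iff) (use QL in \<open>auto simp: split_beta'\<close>)
  qed
  \<comment> \<open>Extension by zero moves the integral to the whole plane, where Lebesgue measure
    is the completion of \<open>lborel\<close>.\<close>
  also have "\<dots> = (\<integral>z. indicat_real ?Q z *\<^sub>R (case z of (x, y) \<Rightarrow> U x y) \<partial>lebesgue)"
    by (rule integral_restrict_space) (use QL in auto)
  also have "\<dots> = (\<integral>z. indicat_real ?Q z *\<^sub>R (case z of (x, y) \<Rightarrow> U x y) \<partial>lborel)"
    using Um unit_square_sets
    by (intro integral_completion borel_measurable_scaleR borel_measurable_indicator) auto
  also have "\<dots> = (\<integral>(x, y). U x y \<partial>(restrict_space lborel ?Q))"
    by (rule integral_restrict_space[symmetric]) (use unit_square_sets in auto)
  finally show ?thesis unfolding pair_unit_eq .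
qed

lemma graph_weight_measurable:
  assumes "simple_graph H" "verts H \<subseteq> I"
  shows "graph_weight U H \<in> borel_measurable (Pi\<^sub>M I (\<lambda>_. unit_measure))"
  unfolding graph_weight_def[abs_def]
proof (rule borel_measurable_prod)
  fix e assume "e \<in> edges H"
  then obtain u v where "u \<in> verts H" "v \<in> verts H" "e = {u, v}"
    using simple_graph_edgeE[OF assms(1)] by metis
  then show "(\<lambda>x. edge_weight U x e) \<in> borel_measurable (Pi\<^sub>M I (\<lambda>_. unit_measure))"
    using U_pair_measurable[of u I v] assms(2) by (auto simp: edge_weight_sym[of U, OF U_sym])
qed

lemma hom_density_eq:
  assumes H: "simple_graph H"
  shows "hom_density H W = (\<integral>x. graph_weight U H x \<partial>power_measure unit_measure)"
proof -
  interpret P: product_prob_space "\<lambda>_. unit_measure" UNIV by (rule product_prob_space_unit)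
  let ?V = "verts H"
  let ?P = "Pi\<^sub>M ?V (\<lambda>_. unit_measure)"
  have fin: "finite ?V" using H by (simp add: simple_graph_def)
  have gm: "graph_weight U H \<in> borel_measurable ?P" by (rule graph_weight_measurable[OF H]) simp
  have "AE x in ?P. \<forall>e\<in>edges H. edge_weight W x e = edge_weight U x e"
  proof (rule AE_finite_allI[OF finite_edges[OF H]])
    fix e assume "e \<in> edges H"
    then obtain u v where uv: "u \<in> ?V" "v \<in> ?V" "u \<noteq> v" "e = {u, v}"
      by (rule simple_graph_edgeE[OF H])
    have "AE z in distr ?P (unit_measure \<Otimes>\<^sub>M unit_measure) (\<lambda>x. (x u, x v)). W (fst z) (snd z) = U (fst z) (snd z)"
      unfolding distr_pair_component[OF prob_space_unit uv(1-3)] by (rule AE_pair_unit)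
    moreover have meas: "(\<lambda>x. (x u, x v)) \<in> measurable ?P (unit_measure \<Otimes>\<^sub>M unit_measure)"
      using uv by (intro measurable_Pair measurable_component_singleton)
    ultimately have "AE x in ?P. W (fst (x u, x v)) (snd (x u, x v)) = U (fst (x u, x v)) (snd (x u, x v))"
      by (intro AE_distrD[OF meas])
    then have "AE x in ?P. W (x u) (x v) = U (x u) (x v)" by simp
    then show "AE x in ?P. edge_weight W x e = edge_weight U x e"
    proof (rule AE_mp, intro AE_I2 impI)
      fix x assume x: "x \<in> space ?P" and eq: "W (x u) (x v) = U (x u) (x v)"
      have "x u \<in> {0..1}" "x v \<in> {0..1}" using x uv
        by (auto simp: space_PiM PiE_iff space_restrict_space)
      then show "edge_weight W x e = edge_weight U x e"
        using eq uv by (simp add: edge_weight_eq[OF W] edge_weight_sym[of U, OF U_sym])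
    qed
  qed
  then have ae: "AE x in completion ?P. graph_weight U H x = (\<Prod>e\<in>edges H. edge_weight W x e)"
    unfolding graph_weight_def
    by (intro AE_completion) (auto elim!: eventually_mono intro!: prod.cong)
  have "hom_density H W = (\<integral>x. graph_weight U H x \<partial>completion ?P)"
    unfolding hom_density_def
    using ae completion.borel_measurable_cong_AE[OF measurable_completion[OF gm] ae] measurable_completion[OF gm]
    by (intro integral_cong_AE) (auto elim!: eventually_mono)
  also have "\<dots> = (\<integral>x. graph_weight U H x \<partial>?P)" by (rule integral_completion[OF gm])
  also have "\<dots> = (\<integral>x. graph_weight U H x \<partial>distr (power_measure unit_measure) ?P (\<lambda>x. restrict x ?V))"
    using P.distr_PiM_restrict_finite[OF fin] by simp
  also have "\<dots> = (\<integral>x. graph_weight U H (restrict x ?V) \<partial>power_measure unit_measure)"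
    by (rule integral_distr[OF _ gm]) (simp add: measurable_restrict_subset)
  also have "\<dots> = (\<integral>x. graph_weight U H x \<partial>power_measure unit_measure)"
    by (intro Bochner_Integration.integral_cong refl depends_onD[OF graph_weight_depends_on[OF H]]) simp
  finally show ?thesis .
qed

lemma hom_density_P2: "hom_density P2 W = (\<integral>(x, y). U x y \<partial>(unit_measure \<Otimes>\<^sub>M unit_measure))"
proof -
  have "simple_graph P2" unfolding P2_def simple_graph_def by auto
  then have "hom_density P2 W = (\<integral>x. graph_weight U P2 x \<partial>power_measure unit_measure)"
    by (rule hom_density_eq)
  also have "\<dots> = (\<integral>x. U (x (0 :: nat)) (x 1) \<partial>power_measure unit_measure)"
    by (simp add: graph_weight_def P2_def edge_weight_sym[of U, OF U_sym])
  also have "\<dots> = (\<integral>z. (case z of (x, y) \<Rightarrow> U x y)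
      \<partial>distr (power_measure unit_measure) (unit_measure \<Otimes>\<^sub>M unit_measure) (\<lambda>x. (x (0 :: nat), x 1)))"
    by (subst integral_distr[OF _ U_measurable])
      (auto simp: measurable_Pair measurable_component_singleton)
  also have "\<dots> = (\<integral>(x, y). U x y \<partial>(unit_measure \<Otimes>\<^sub>M unit_measure))"
    by (subst distr_pair_component[OF prob_space_unit]) auto
  finally show ?thesis .
qed

text \<open>The entropy argument needs a graphon bounded away from zero, so it is applied to the
  convex combinations of \<open>U\<close> with the constant graphon 1.\<close>

lemma graph_weight_reflections:
  assumes H: "reflections T H" "tree T"
  shows "(\<integral>(x, y). U x y \<partial>(unit_measure \<Otimes>\<^sub>M unit_measure)) ^ card (edges H)
    \<le> (\<integral>x. graph_weight U H x \<partial>power_measure unit_measure)"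
proof -
  interpret prob_space unit_measure by (rule prob_space_unit)
  interpret PP: pair_prob_space unit_measure unit_measure ..
  interpret P: product_prob_space "\<lambda>_. unit_measure" UNIV by (rule product_prob_space_unit)
  have sH: "simple_graph H" using reflections_invariant[OF H] by blast
  define V where "V n s t = U s t + inverse (real (Suc n)) * (1 - U s t)" for n s t
  have V_sym: "V n s t = V n t s" for n s t unfolding V_def using U_sym[of s t] by simp
  have V_ge: "U s t \<le> V n s t" for n s t
    unfolding V_def using U_le_1[of s t] by simp
  have V_le: "V n s t \<le> 1" for n s t
  proof -
    have "inverse (real (Suc n)) * (1 - U s t) \<le> 1 * (1 - U s t)"
      using U_le_1[of s t] by (intro mult_right_mono) (auto simp: field_simps)
    then show ?thesis unfolding V_def by simp
  qed
  have V_pos: "inverse (real (Suc n)) \<le> V n s t" for n s t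
  proof -
    have "inverse (real (Suc n)) * U s t \<le> 1 * U s t"
      using U_nonneg[of s t] by (intro mult_right_mono) (auto simp: field_simps)
    then show ?thesis unfolding V_def by (simp add: algebra_simps)
  qed
  have V_meas: "(\<lambda>(s, t). V n s t) \<in> borel_measurable (unit_measure \<Otimes>\<^sub>M unit_measure)" for n
    using U_measurable unfolding V_def split_beta' by measurable
  have V_positive: "positive_meas (unit_measure \<Otimes>\<^sub>M unit_measure) (\<lambda>(s, t). V n s t)" for n
    by (rule positive_measI[OF V_meas[of n], of "inverse (real (Suc n))" 1])
      (auto simp: V_pos V_le simp del: of_nat_Suc)
  have graphon: "positive_graphon unit_measure (V n)" for n
    by (intro positive_graphon.intro positive_graphon_axioms.intro prob_space_unit V_positive V_sym)
  let ?p = "\<integral>(x, y). U x y \<partial>(unit_measure \<Otimes>\<^sub>M unit_measure)"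
  have intU: "integrable (unit_measure \<Otimes>\<^sub>M unit_measure) (\<lambda>(s, t). U s t)"
    by (rule PP.bounded_meas_integrable[OF bounded_measI[OF U_measurable, of 1]])
      (auto simp: U_nonneg U_le_1)
  \<comment> \<open>The left side uses the density of \<open>U\<close>, a lower bound for that of
    each \<open>V n\<close>, so only the right side varies with \<open>n\<close> in the
    limit.\<close>
  have le: "?p ^ card (edges H) \<le> (\<integral>x. graph_weight (V n) H x \<partial>power_measure unit_measure)" for n
  proof -
    interpret positive_graphon unit_measure "V n" by (rule graphon)
    have int: "integrable (unit_measure \<Otimes>\<^sub>M unit_measure) (\<lambda>(s, t). V n s t)"
      by (rule PP.bounded_meas_integrable[OF positive_meas_bounded[OF V_positive]])
    have "?p \<le> (\<integral>(x, y). V n x y \<partial>(unit_measure \<Otimes>\<^sub>M unit_measure))"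
      using V_ge by (intro integral_mono intU int) auto
    also have "\<dots> = p"
      using PP.integral_fst'[OF int] unfolding p_def deg_def by simp
    finally have "?p ^ card (edges H) \<le> p ^ card (edges H)"
      using U_nonneg by (intro power_mono integral_nonneg_AE) auto
    also have "\<dots> \<le> (\<integral>x. graph_weight (V n) H x \<partial>power_measure unit_measure)"
      by (rule reflections_weight[OF H])
    finally show ?thesis .
  qed
  have "(\<lambda>n. \<integral>x. graph_weight (V n) H x \<partial>power_measure unit_measure)
    \<longlonglongrightarrow> (\<integral>x. graph_weight U H x \<partial>power_measure unit_measure)"
  proof (rule integral_dominated_convergence[where w = "\<lambda>_. 1"])
    show "graph_weight U H \<in> borel_measurable (power_measure unit_measure)"
      by (rule graph_weight_measurable[OF sH]) simp
    show "graph_weight (V n) H \<in> borel_measurable (power_measure unit_measure)" for n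
      by (rule positive_meas_measurable[OF positive_graphon.graph_weight_pos[OF graphon V_positive V_sym sH]])
    have ew: "edge_weight (V n) x e = edge_weight U x e + inverse (real (Suc n)) * (1 - edge_weight U x e)"
      if "e \<in> edges H" for n e x
    proof -
      obtain u v where "e = {u, v}" by (rule simple_graph_edgeE[OF sH \<open>e \<in> edges H\<close>])
      then show ?thesis
        by (simp add: edge_weight_sym[of U, OF U_sym] edge_weight_sym[of "V n", OF V_sym] V_def)
    qed
    have "(\<lambda>n. edge_weight (V n) x e) \<longlonglongrightarrow> edge_weight U x e" if "e \<in> edges H" for x e
    proof -
      have "(\<lambda>n. edge_weight U x e + inverse (real (Suc n)) * (1 - edge_weight U x e))
        \<longlonglongrightarrow> edge_weight U x e + 0 * (1 - edge_weight U x e)"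
        by (intro tendsto_intros LIMSEQ_inverse_real_of_nat)
      then show ?thesis using ew[OF that] by simp
    qed
    then show "AE x in power_measure unit_measure. (\<lambda>n. graph_weight (V n) H x) \<longlonglongrightarrow> graph_weight U H x"
      unfolding graph_weight_def by (intro AE_I2 tendsto_prod) blast
    have "\<bar>graph_weight (V n) H x\<bar> \<le> 1" for n x
    proof -
      have "0 \<le> edge_weight (V n) x e \<and> edge_weight (V n) x e \<le> 1" if "e \<in> edges H" for e
      proof -
        obtain u v where "e = {u, v}" by (rule simple_graph_edgeE[OF sH \<open>e \<in> edges H\<close>])
        then show ?thesis
          using V_le order_trans[OF U_nonneg V_ge]
          by (simp add: edge_weight_sym[of "V n", OF V_sym])
      qed
      then show ?thesis unfolding graph_weight_def
        by (simp add: abs_prod prod_le_1)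
    qed
    then show "AE x in power_measure unit_measure. norm (graph_weight (V n) H x) \<le> 1" for n by simp
  qed simp
  then show ?thesis by (rule LIMSEQ_le_const) (use le in blast)
qed

lemma hom_density_reflections:
  assumes "reflections T H" "tree T"
  shows "hom_density P2 W ^ card (edges H) \<le> hom_density H W"
  using graph_weight_reflections[OF assms] reflections_invariant[OF assms]
  by (simp add: hom_density_eq hom_density_P2)

lemma hom_density_P2_lebesgue:
  "hom_density P2 W = (\<integral>(x, y). W x y \<partial>(lebesgue_on ({0..1} \<times> {0..1})))"
  using hom_density_P2 lebesgue_integral_eq by simp

end

theorem theorem1:
  fixes H :: "'a ugraph"
  assumes "reflection_tree H"
  shows "sidorenko_graph H \<and>
    (\<forall>W. graphon W \<longrightarrow>
      hom_density H W \<ge>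
        (\<integral>(x, y). W x y \<partial>(lebesgue_on ({0..1} \<times> {0..1}))) ^ card (edges H))"
proof -
  obtain T where T: "tree T" "reflections T H" using assms unfolding reflection_tree_def by blast
  have "hom_density P2 W ^ card (edges H) \<le> hom_density H W \<and>
    hom_density P2 W = (\<integral>(x, y). W x y \<partial>(lebesgue_on ({0..1} \<times> {0..1})))" if W: "graphon W" for W
  proof -
    obtain U where "borel_version W U" by (rule borel_version_exists[OF W])
    then show ?thesis
      using hom_density_reflections[OF W _ T(2,1)] hom_density_P2_lebesgue[OF W] by blast
  qed
  then show ?thesis
    using reflections_bipartite[OF T(2,1)] unfolding sidorenko_graph_def by metis
qed

end
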